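(* Let $(\Gamma,\mathcal{G}_\Gamma)$ and $(\Sigma,\mathcal{G}_\Sigma)$ be labeled graphs whose vertex groups are all directly-indecomposable cyclic groups. If there exists a group isomorphism $W(\Gamma,\mathcal{G}_\Gamma)\to W(\Sigma,\mathcal{G}_\Sigma)$, then there exists a labeled-graph isomorphism $(\Gamma,\mathcal{G}_\Gamma)\to(\Sigma,\mathcal{G}_\Sigma)$.
   Context: A labeled graph $(\Lambda,\mathcal{G}_\Lambda)$ consists of a nonempty finite simplicial graph $\Lambda$ with vertex set $V_\Lambda$ and a family $\mathcal{G}_\Lambda=\{G_v\}_{v\in V_\Lambda}$ of nontrivial groups. Its graph product $W(\Lambda,\mathcal{G}_\Lambda)$ is the quotient of the free product $\ast_{v}G_v$ by the relations $gh=hg$ for all $g\in G_v$, $h\in G_{v'}$ with $v,v'$ adjacent in $\Lambda$. A labeled-graph isomorphism $(\Gamma,\mathcal{G}_\Gamma)\to(\Sigma,\mathcal{G}_\Sigma)$ is a bijection $f:V_\Gamma\to V_\Sigma$ such that $u,v$ are adjacent in $\Gamma$ iff $f(u),f(v)$ are adjacent in $\Sigma$, and $G_u\cong G_{f(u)}$ for all $u\in V_\Gamma$. A cyclic group is directly-indecomposable if it is infinite or has prime-power order. *)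

theory Defs
  imports "HOL-Algebra.Algebra"
begin

definition labeled_graph :: "'a set \<Rightarrow> ('a \<Rightarrow> 'a \<Rightarrow> bool) \<Rightarrow> ('a \<Rightarrow> ('g, 'c) monoid_scheme) \<Rightarrow> bool" where
  "labeled_graph V E G \<longleftrightarrow> finite V \<and> V \<noteq> {} \<and>
     (\<forall>u\<in>V. \<forall>v\<in>V. E u v \<longrightarrow> E v u) \<and> (\<forall>v\<in>V. \<not> E v v) \<and>
     (\<forall>v\<in>V. group (G v) \<and> carrier (G v) \<noteq> {\<one>\<^bsub>G v\<^esub>})"

definition dir_indec_cyclic :: "('g, 'c) monoid_scheme \<Rightarrow> bool" where
  "dir_indec_cyclic H \<longleftrightarrow> group H \<and> cyclic_group H \<and>
     (infinite (carrier H) \<or> (\<exists>p k. Factorial_Ring.prime (p::nat) \<and> card (carrier H) = p ^ k))"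

text \<open>Graph product as the quotient of the free product *_v G_v: words over letters (v,g)
  with g in G v, modulo the congruence generated by the free-product relations
  (v,g)(v,h) = (v, g h), (v,1) = empty word, and the commutation relations
  (u,g)(v,h) = (v,h)(u,g) for adjacent u, v.\<close>
inductive gp_rel :: "'a set \<Rightarrow> ('a \<Rightarrow> 'a \<Rightarrow> bool) \<Rightarrow> ('a \<Rightarrow> ('g, 'c) monoid_scheme)
    \<Rightarrow> ('a \<times> 'g) list \<Rightarrow> ('a \<times> 'g) list \<Rightarrow> bool"
  for V E G where
  gp_mult: "\<lbrakk>v \<in> V; g \<in> carrier (G v); h \<in> carrier (G v)\<rbrakk>
      \<Longrightarrow> gp_rel V E G [(v,g),(v,h)] [(v, g \<otimes>\<^bsub>G v\<^esub> h)]"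
| gp_one: "v \<in> V \<Longrightarrow> gp_rel V E G [(v, \<one>\<^bsub>G v\<^esub>)] []"
| gp_comm: "\<lbrakk>u \<in> V; v \<in> V; E u v; g \<in> carrier (G u); h \<in> carrier (G v)\<rbrakk>
      \<Longrightarrow> gp_rel V E G [(u,g),(v,h)] [(v,h),(u,g)]"
| gp_refl: "gp_rel V E G w w"
| gp_sym: "gp_rel V E G w w' \<Longrightarrow> gp_rel V E G w' w"
| gp_trans: "gp_rel V E G w w' \<Longrightarrow> gp_rel V E G w' w'' \<Longrightarrow> gp_rel V E G w w''"
| gp_ctxt: "gp_rel V E G w w' \<Longrightarrow> gp_rel V E G (xs @ w @ ys) (xs @ w' @ ys)"

definition gp_words :: "'a set \<Rightarrow> ('a \<Rightarrow> ('g, 'c) monoid_scheme) \<Rightarrow> ('a \<times> 'g) list set" where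
  "gp_words V G = {w. \<forall>(v,g) \<in> set w. v \<in> V \<and> g \<in> carrier (G v)}"

definition gp_class :: "'a set \<Rightarrow> ('a \<Rightarrow> 'a \<Rightarrow> bool) \<Rightarrow> ('a \<Rightarrow> ('g, 'c) monoid_scheme)
    \<Rightarrow> ('a \<times> 'g) list \<Rightarrow> ('a \<times> 'g) list set" where
  "gp_class V E G w = {w'. gp_rel V E G w w'}"

definition graph_product :: "'a set \<Rightarrow> ('a \<Rightarrow> 'a \<Rightarrow> bool) \<Rightarrow> ('a \<Rightarrow> ('g, 'c) monoid_scheme)
    \<Rightarrow> ('a \<times> 'g) list set monoid" where
  "graph_product V E G =
    \<lparr> carrier = gp_class V E G ` gp_words V G,
      monoid.mult = (\<lambda>A B. \<Union>a\<in>A. \<Union>b\<in>B. gp_class V E G (a @ b)),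
      monoid.one = gp_class V E G [] \<rparr>"

definition labeled_graph_iso ::
  "('a \<Rightarrow> 'b) \<Rightarrow> 'a set \<Rightarrow> ('a \<Rightarrow> 'a \<Rightarrow> bool) \<Rightarrow> ('a \<Rightarrow> ('g, 'c) monoid_scheme)
    \<Rightarrow> 'b set \<Rightarrow> ('b \<Rightarrow> 'b \<Rightarrow> bool) \<Rightarrow> ('b \<Rightarrow> ('h, 'd) monoid_scheme) \<Rightarrow> bool" where
  "labeled_graph_iso f V E G V' E' G' \<longleftrightarrow> bij_betw f V V' \<and>
     (\<forall>u\<in>V. \<forall>v\<in>V. E u v \<longleftrightarrow> E' (f u) (f v)) \<and>
     (\<forall>u\<in>V. G u \<cong> G' (f u))"

end

theory Submission
  imports Defs "HOL-Analysis.Convex" "HOL-Analysis.Elementary_Normed_Spaces"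
    "HOL-Number_Theory.Cong" "Jordan_Normal_Form.Determinant"
begin

text \<open>Exponent sums turn an isomorphism of graph products into integer matrices, indexed by the
  vertices of the two graphs, which are invertible modulo a prime on the block of vertices of any given
  order. Expanding a determinant gives a bijection of the vertices along which all matrix entries are
  units. Such a bijection preserves edges, because explicit representations show that elements
  which have suitable exponents at two non-adjacent vertices cannot commute: for two finite vertices a
  family of two-dimensional complex representations is used, for a finite and an infinite vertex
  a wreath product, and for two infinite vertices the Heisenberg group. In the last case
  the bijection has to be chosen with more care: comparing the sizes of stars confines failures to
  vertices with equal links, and these are avoided by cancelling the corresponding terms of the
  determinant in pairs. Counting edges then shows that the bijection is an isomorphism.\<close>

section \<open>Matrices invertible modulo a prime\<close>

text \<open>The block of \<open>\<Phi>\<close> between vertices of one order is invertible modulo a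
  prime p dividing that order, because every product \<open>\<Phi> u v * \<Psi> v w\<close> through
  a vertex \<open>v\<close> of another order vanishes modulo p. Infinite vertices have order 0,
  which every prime divides; 2 is chosen there because vectors modulo 2 are subsets, so that a
  counting of subsets of stars becomes available. The obstacle for two infinite vertices is that
  commuting elements of infinite order, for instance two powers of one element, can both have
  nonzero exponents at two non-adjacent vertices; the Heisenberg group only yields a vanishing 2x2
  minor. Torsion elements are more rigid: at two non-adjacent finite vertices one of the exponents
  is trivial, and a product of commuting torsion elements is again torsion. No normal form of words
  enters: all invariants are exponent sums and explicit actions, which only have to respect the
  defining relations.\<close>

lemma det_cong_mod:
  fixes A B :: "int mat"
  assumes "A \<in> carrier_mat n n" "B \<in> carrier_mat n n"
    and "\<And>i j. i < n \<Longrightarrow> j < n \<Longrightarrow> [A $$ (i, j) = B $$ (i, j)] (mod m)"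
  shows "[det A = det B] (mod m)"
proof -
  have "q i < n" if "q permutes {0..<n}" "i < n" for q i
    using that permutes_in_image by fastforce
  then have "[signof q * (\<Prod>i = 0..<n. A $$ (i, q i)) = signof q * (\<Prod>i = 0..<n. B $$ (i, q i))] (mod m)"
    if "q permutes {0..<n}" for q
    using that by (intro cong_mult cong_prod cong_refl assms(3)) auto
  then show ?thesis
    unfolding det_def'[OF assms(1)] det_def'[OF assms(2)]
    by (intro cong_sum) simp
qed

text \<open>Composing \<open>q\<close> with a transposition flips the sign and alters only two
  factors, replacing the diagonal product of a 2x2 submatrix by the antidiagonal one. A minor that
  vanishes modulo \<open>m\<close> thus makes the two terms cancel.\<close>

lemma swap_terms_cancel:
  fixes A :: "int mat"
  assumes q: "q permutes {0..<n}" and cd: "c < n" "d < n" "c \<noteq> d"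
    and prp: "[A $$ (q c, c) * A $$ (q d, d) = A $$ (q d, c) * A $$ (q c, d)] (mod m)"
  shows "m dvd signof q * (\<Prod>j<n. A $$ (q j, j))
     + signof (q \<circ> Transposition.transpose c d) * (\<Prod>j<n. A $$ ((q \<circ> Transposition.transpose c d) j, j))"
proof -
  let ?t = "Transposition.transpose c d" 
  have "permutation q" "permutation ?t"
    using q by (simp_all add: permutes_imp_permutation[OF finite_atLeastLessThan] permutation_swap_id)
  then have "sign (q \<circ> ?t) = - sign q"
    using cd by (simp add: sign_compose sign_swap_id)
  then have sgn: "(signof (q \<circ> ?t) :: int) = - signof q"
    by simp
  define rest where "rest = (\<Prod>j\<in>{..<n} - {c, d}. A $$ (q j, j))"
  have split: "(\<Prod>j<n. h j) = h c * h d * (\<Prod>j\<in>{..<n} - {c, d}. h j)" for h :: "nat \<Rightarrow> int"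
  proof -
    have "(\<Prod>j<n. h j) = (\<Prod>j\<in>{..<n} - {c, d}. h j) * (\<Prod>j\<in>{c, d}. h j)"
      using cd by (intro prod.subset_diff) auto
    then show ?thesis using cd by simp
  qed
  have r: "(\<Prod>j\<in>{..<n} - {c, d}. A $$ ((q \<circ> ?t) j, j)) = rest"
    unfolding rest_def by (intro prod.cong) (auto simp: Transposition.transpose_def)
  have a: "(\<Prod>j<n. A $$ (q j, j)) = A $$ (q c, c) * A $$ (q d, d) * rest"
    by (subst split) (simp add: rest_def)
  have b: "(\<Prod>j<n. A $$ ((q \<circ> ?t) j, j)) = A $$ (q d, c) * A $$ (q c, d) * rest"
    by (subst split) (simp only: r, simp)
  have "signof q * (\<Prod>j<n. A $$ (q j, j))
     + signof (q \<circ> ?t) * (\<Prod>j<n. A $$ ((q \<circ> ?t) j, j))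
    = signof q * rest * (A $$ (q c, c) * A $$ (q d, d) - A $$ (q d, c) * A $$ (q c, d))"
    unfolding a b sgn by (simp add: algebra_simps)
  then show ?thesis
    using prp unfolding cong_iff_dvd_diff by (metis dvd_mult)
qed

text \<open>The terms of the determinant are grouped by the class function \<open>\<kappa> \<circ> q\<close>. In a
  group that violates the last condition, swapping two proportional columns cancels the terms in
  pairs.\<close>
lemma det_nonzero_transversal:
  fixes A :: "int mat" and \<kappa> :: "nat \<Rightarrow> 'k"
  assumes A: "A \<in> carrier_mat n n" and det: "\<not> m dvd det A"
    and irr: "\<And>c. c < n \<Longrightarrow> \<not> R c c"
    and prp: "\<And>c d i j. \<lbrakk>c < n; d < n; R c d; i < n; j < n; \<kappa> i = \<kappa> j\<rbrakk>
      \<Longrightarrow> [A $$ (i, c) * A $$ (j, d) = A $$ (j, c) * A $$ (i, d)] (mod m)"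
  obtains q where "q permutes {0..<n}" "\<not> m dvd (\<Prod>j<n. A $$ (q j, j))"
    "\<And>c d. c < n \<Longrightarrow> d < n \<Longrightarrow> R c d \<Longrightarrow> \<kappa> (q c) \<noteq> \<kappa> (q d)"
proof -
  define P where "P = {q. q permutes {0..<n}}"
  define t where "t q = signof q * (\<Prod>j<n. A $$ (q j, j))" for q
  define K where "K q = restrict (\<kappa> \<circ> q) {0..<n}" for q
  have finP: "finite P" unfolding P_def by (simp add: finite_permutations)
  have lt: "q i < n" if "q \<in> P" "i < n" for q i
    using that permutes_in_image unfolding P_def by fastforce
  have "det A = sum t P"
    unfolding t_def P_def using det_col[OF A] by simp
  also have "\<dots> = (\<Sum>k\<in>K ` P. sum t {q \<in> P. K q = k})"
    by (rule sum.image_gen[OF finP])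
  finally have "\<exists>k\<in>K ` P. \<not> m dvd sum t {q \<in> P. K q = k}"
    using det by (metis (no_types, lifting) dvd_sum)
  then obtain k where k: "k \<in> K ` P" "\<not> m dvd sum t {q \<in> P. K q = k}" by blast
  have good: "k c \<noteq> k d" if cd: "c < n" "d < n" "R c d" for c d
  proof
    assume eq: "k c = k d"
    define S where "S = {q \<in> P. K q = k}"
    have ne: "c \<noteq> d" using irr cd by blast
    \<comment> \<open>An involution of \<open>S\<close> that exchanges even and odd permutations; it
      splits the sum over \<open>S\<close> into pairs.\<close>
    define \<iota> where "\<iota> q = q \<circ> Transposition.transpose c d" for q :: "nat \<Rightarrow> nat"
    have inv: "\<iota> (\<iota> q) = q" for q
      unfolding \<iota>_def by (simp add: comp_assoc)
    have tp: "Transposition.transpose c d permutes {0..<n}"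
      using cd by (simp add: permutes_swap_id)
    have perm: "permutation q" if "q \<in> P" for q
      using that by (simp add: P_def permutes_imp_permutation[OF finite_atLeastLessThan])
    have S: "\<iota> q \<in> S" if "q \<in> S" for q
    proof -
      have q: "q \<in> P" "K q = k" using that by (auto simp: S_def)
      then have "\<kappa> (q c) = \<kappa> (q d)"
        using eq cd by (auto simp: K_def)
      then have "K (\<iota> q) = K q"
        using cd by (auto simp: K_def \<iota>_def restrict_def Transposition.transpose_def fun_eq_iff)
      then show ?thesis
        using q tp by (auto simp: S_def P_def \<iota>_def intro: permutes_compose)
    qed
    have ev: "evenperm (\<iota> q) \<longleftrightarrow> \<not> evenperm q" if "q \<in> S" for q
      using that ne perm by (simp add: \<iota>_def S_def evenperm_comp evenperm_swap permutation_swap_id)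
    have finS: "finite S" using finP by (simp add: S_def)
    have "sum t S = sum t {q \<in> S. evenperm q} + sum t {q \<in> S. \<not> evenperm q}"
    proof -
      have "S - {q \<in> S. evenperm q} = {q \<in> S. \<not> evenperm q}" by blast
      then show ?thesis
        using finS sum.subset_diff[of "{q \<in> S. evenperm q}" S t] by (simp add: add.commute)
    qed
    also have "sum t {q \<in> S. \<not> evenperm q} = (\<Sum>q\<in>{q \<in> S. evenperm q}. t (\<iota> q))"
      by (rule sum.reindex_bij_witness[of _ \<iota> \<iota>]) (auto simp: inv S ev)
    finally have sum_S: "sum t S = (\<Sum>q\<in>{q \<in> S. evenperm q}. t q + t (\<iota> q))"
      by (simp add: sum.distrib)
    have pair: "m dvd t q + t (\<iota> q)" if "q \<in> S" for q
    proof -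
      have q: "q \<in> P" "K q = k" using that by (auto simp: S_def)
      then have "\<kappa> (q c) = \<kappa> (q d)" using eq cd by (auto simp: K_def)
      then have "[A $$ (q c, c) * A $$ (q d, d) = A $$ (q d, c) * A $$ (q c, d)] (mod m)"
        using q cd lt by (intro prp) auto
      then show ?thesis
        unfolding t_def \<iota>_def using q cd ne by (intro swap_terms_cancel) (auto simp: P_def)
    qed
    have "m dvd sum t S"
      unfolding sum_S by (rule dvd_sum) (use pair in blast)
    then show False using k by (simp add: S_def)
  qed
  have "\<exists>q\<in>{q \<in> P. K q = k}. \<not> m dvd t q"
    using k by (metis (no_types, lifting) dvd_sum)
  then obtain q where q: "q \<in> P" "K q = k" "\<not> m dvd t q" by blast
  show thesis
  proof
    show "q permutes {0..<n}" using q by (simp add: P_def)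
    show "\<not> m dvd (\<Prod>j<n. A $$ (q j, j))" using q by (auto simp: t_def)
    show "\<kappa> (q c) \<noteq> \<kappa> (q d)" if "c < n" "d < n" "R c d" for c d
      using good[OF that] q that by (auto simp: K_def)
  qed
qed


text \<open>Zero columns pad \<open>\<Phi>\<close>, and zero rows pad \<open>\<Psi>\<close>, to
  square matrices of size \<open>card B\<close> whose product is still the identity modulo
  \<open>m\<close>. A nonzero term of the determinant then avoids all padded columns, so there are
  none: the cardinalities agree and the term is a bijection.\<close>

lemma invertible_mod_transversal:
  fixes \<Phi> :: "'b \<Rightarrow> 'a \<Rightarrow> int" and \<Psi> :: "'a \<Rightarrow> 'b \<Rightarrow> int"
  assumes fin: "finite A" "finite B" and le: "card A \<le> card B" and m: "\<not> is_unit m"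
    and inv: "\<And>u w. \<lbrakk>u \<in> B; w \<in> B\<rbrakk> \<Longrightarrow> [(\<Sum>v\<in>A. \<Phi> u v * \<Psi> v w) = of_bool (u = w)] (mod m)"
    and irr: "\<And>v. v \<in> A \<Longrightarrow> \<not> R v v"
    and prp: "\<And>v w r s. \<lbrakk>v \<in> A; w \<in> A; R v w; r \<in> B; s \<in> B; \<kappa> r = \<kappa> s\<rbrakk>
      \<Longrightarrow> [\<Phi> r v * \<Phi> s w = \<Phi> s v * \<Phi> r w] (mod m)"
  obtains \<sigma> where "bij_betw \<sigma> A B" "\<And>v. v \<in> A \<Longrightarrow> \<not> m dvd \<Phi> (\<sigma> v) v"
    "\<And>v w. \<lbrakk>v \<in> A; w \<in> A; R v w\<rbrakk> \<Longrightarrow> \<kappa> (\<sigma> v) \<noteq> \<kappa> (\<sigma> w)"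
proof -
  define n where "n = card B"
  define k where "k = card A"
  have kn: "k \<le> n" using le by (simp add: n_def k_def)
  obtain a where a: "bij_betw a {0..<k} A"
    using ex_bij_betw_nat_finite[OF fin(1)] by (auto simp: k_def)
  obtain b where b: "bij_betw b {0..<n} B"
    using ex_bij_betw_nat_finite[OF fin(2)] by (auto simp: n_def)
  have aA: "a i \<in> A" if "i < k" for i using a that by (auto simp: bij_betw_def)
  have bB: "b i \<in> B" if "i < n" for i using b that by (auto simp: bij_betw_def)
  define M where "M = mat n n (\<lambda>(i, j). if j < k then \<Phi> (b i) (a j) else 0)"
  define N where "N = mat n n (\<lambda>(i, j). if i < k then \<Psi> (a i) (b j) else 0)"
  have M: "M \<in> carrier_mat n n" and N: "N \<in> carrier_mat n n" by (auto simp: M_def N_def)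
  have "[(M * N) $$ (i, j) = 1\<^sub>m n $$ (i, j)] (mod m)" if ij: "i < n" "j < n" for i j
  proof -
    have "(M * N) $$ (i, j) = (\<Sum>l = 0..<n. M $$ (i, l) * N $$ (l, j))"
      using ij M N by (simp add: scalar_prod_def)
    also have "\<dots> = (\<Sum>l = 0..<k. M $$ (i, l) * N $$ (l, j))"
      using kn ij by (intro sum.mono_neutral_right) (auto simp: M_def)
    also have "\<dots> = (\<Sum>l = 0..<k. \<Phi> (b i) (a l) * \<Psi> (a l) (b j))"
      using kn ij by (intro sum.cong) (auto simp: M_def N_def)
    also have "\<dots> = (\<Sum>v\<in>A. \<Phi> (b i) v * \<Psi> v (b j))"
      by (rule sum.reindex_bij_betw[OF a])
    finally have "[(M * N) $$ (i, j) = of_bool (b i = b j)] (mod m)"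
      using inv bB ij by simp
    moreover have "b i = b j \<longleftrightarrow> i = j"
      using b ij by (auto simp: bij_betw_def inj_on_def)
    moreover have "1\<^sub>m n $$ (i, j) = (of_bool (i = j) :: int)"
      using ij by simp
    ultimately show ?thesis by (simp only:)
  qed
  then have "[det (M * N) = det (1\<^sub>m n :: int mat)] (mod m)"
    using M N by (intro det_cong_mod[where n = n]) auto
  then have "[det M * det N = 1] (mod m)"
    using det_mult[OF M N] by simp
  then have detM: "\<not> m dvd det M"
    using m cong_dvd_iff[of "det M * det N" 1 m] by auto
  define R' where "R' c d \<longleftrightarrow> c < k \<and> d < k \<and> R (a c) (a d)" for c d
  have R'_irr: "\<not> R' c c" for c using irr aA by (auto simp: R'_def)
  have R'_prp: "[M $$ (i, c) * M $$ (j, d) = M $$ (j, c) * M $$ (i, d)] (mod m)"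
    if "c < n" "d < n" "R' c d" "i < n" "j < n" "(\<kappa> \<circ> b) i = (\<kappa> \<circ> b) j" for c d i j
    using that prp[of "a c" "a d" "b i" "b j"] aA bB by (auto simp: M_def R'_def)
  obtain q where q: "q permutes {0..<n}" "\<not> m dvd (\<Prod>j<n. M $$ (q j, j))"
    "\<And>c d. c < n \<Longrightarrow> d < n \<Longrightarrow> R' c d \<Longrightarrow> (\<kappa> \<circ> b) (q c) \<noteq> (\<kappa> \<circ> b) (q d)"
    by (rule det_nonzero_transversal[OF M detM R'_irr R'_prp]) (assumption | rule that)+
  have qn: "q j < n" if "j < n" for j
    using that permutes_in_image[OF q(1)] by fastforce
  have nz: "\<not> m dvd M $$ (q j, j)" if "j < n" for j
    using q(2) that by (meson dvd_prodI dvd_trans finite_lessThan lessThan_iff)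
  have "k = n"
  proof (rule ccontr)
    assume "k \<noteq> n"
    then have "k < n" using kn by simp
    then show False using nz[of k] qn[of k] by (simp add: M_def)
  qed
  define \<sigma> where "\<sigma> = b \<circ> q \<circ> the_inv_into {0..<k} a"
  have \<sigma>a: "\<sigma> (a j) = b (q j)" if "j < k" for j
    using that a by (simp add: \<sigma>_def bij_betw_def the_inv_into_f_f)
  have surj: "\<exists>j<k. a j = v" if "v \<in> A" for v
    using that a by (auto simp: bij_betw_def)
  show thesis
  proof
    have "bij_betw (the_inv_into {0..<k} a) A {0..<n}"
      using bij_betw_the_inv_into[OF a] \<open>k = n\<close> by simp
    then show "bij_betw \<sigma> A B"
      unfolding \<sigma>_def using permutes_imp_bij[OF q(1)] b
      by (metis bij_betw_trans)
  next
    fix v assume "v \<in> A"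
    then obtain j where "j < k" "a j = v" using surj by blast
    then show "\<not> m dvd \<Phi> (\<sigma> v) v"
      using nz[of j] qn[of j] \<sigma>a[of j] kn by (auto simp: M_def)
  next
    fix v w assume "v \<in> A" "w \<in> A" and R: "R v w"
    then obtain i j where ij: "i < k" "a i = v" "j < k" "a j = w" using surj by metis
    then have "(\<kappa> \<circ> b) (q i) \<noteq> (\<kappa> \<circ> b) (q j)"
      using R kn by (intro q(3)) (auto simp: R'_def)
    then show "\<kappa> (\<sigma> v) \<noteq> \<kappa> (\<sigma> w)"
      using ij \<sigma>a by auto
  qed
qed

text \<open>If \<open>A\<close> were smaller, padding would produce a bijection between sets of
  different sizes. No side condition is wanted, hence the empty \<open>R\<close> and the constant
  \<open>\<kappa>\<close>.\<close>

lemma right_invertible_mod_card_le: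
  fixes \<Phi> :: "'b \<Rightarrow> 'a \<Rightarrow> int" and \<Psi> :: "'a \<Rightarrow> 'b \<Rightarrow> int"
  assumes "finite A" "finite B" "\<not> is_unit m"
    and "\<And>u w. \<lbrakk>u \<in> B; w \<in> B\<rbrakk> \<Longrightarrow> [(\<Sum>v\<in>A. \<Phi> u v * \<Psi> v w) = of_bool (u = w)] (mod m)"
  shows "card B \<le> card A"
proof (rule ccontr)
  assume "\<not> card B \<le> card A"
  then have le: "card A \<le> card B" by simp
  obtain \<sigma> where "bij_betw \<sigma> A B"
  proof (rule invertible_mod_transversal[of A B m \<Phi> \<Psi> "\<lambda>_ _. False" "\<lambda>_. ()"])
    show "[(\<Sum>v\<in>A. \<Phi> u v * \<Psi> v w) = of_bool (u = w)] (mod m)" if "u \<in> B" "w \<in> B" for u w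
      using assms(4) that .
  qed (use assms(1-3) le in blast)+
  then show False
    using \<open>\<not> card B \<le> card A\<close> by (simp add: bij_betw_same_card)
qed

section \<open>Graphs and parity matrices\<close>

text \<open>Stars and links are taken inside a set \<open>A\<close>, since they will be used in the
  subgraph of infinite vertices rather than in the whole graph.\<close>

definition star :: "('a \<Rightarrow> 'a \<Rightarrow> bool) \<Rightarrow> 'a set \<Rightarrow> 'a \<Rightarrow> 'a set" where
  "star E A v = {w \<in> A. w = v \<or> E v w}"

definition link :: "('a \<Rightarrow> 'a \<Rightarrow> bool) \<Rightarrow> 'a set \<Rightarrow> 'a \<Rightarrow> 'a set" where
  "link E A v = {w \<in> A. E v w}"

text \<open>Models the infinite vertices of the two graphs, with the exponent matrices of an
  isomorphism and of its inverse. The assumption \<open>minor\<close> is what the Heisenberg group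
  says about the commuting images of two adjacent generators. The locale is directed and will be
  instantiated in both directions.\<close>

locale parity_map =
  fixes A :: "'a set" and B :: "'b set" and E :: "'a \<Rightarrow> 'a \<Rightarrow> bool" and E' :: "'b \<Rightarrow> 'b \<Rightarrow> bool"
    and \<Phi> :: "'b \<Rightarrow> 'a \<Rightarrow> int" and \<Psi> :: "'a \<Rightarrow> 'b \<Rightarrow> int"
  assumes fin: "finite A" "finite B"
    and sym: "\<And>u v. \<lbrakk>u \<in> B; v \<in> B; E' u v\<rbrakk> \<Longrightarrow> E' v u"
    and irr: "\<And>v. v \<in> A \<Longrightarrow> \<not> E v v"
    and linv: "\<And>v w. \<lbrakk>v \<in> A; w \<in> A\<rbrakk> \<Longrightarrow> [(\<Sum>u\<in>B. \<Psi> v u * \<Phi> u w) = of_bool (v = w)] (mod 2)"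
    and rinv: "\<And>u t. \<lbrakk>u \<in> B; t \<in> B\<rbrakk> \<Longrightarrow> [(\<Sum>v\<in>A. \<Phi> u v * \<Psi> v t) = of_bool (u = t)] (mod 2)"
    and minor: "\<And>v w u t. \<lbrakk>v \<in> A; w \<in> A; E v w; u \<in> B; t \<in> B; u \<noteq> t; \<not> E' u t\<rbrakk>
      \<Longrightarrow> \<Phi> u v * \<Phi> t w = \<Phi> t v * \<Phi> u w"
begin

text \<open>Row \<open>r\<close> of the matrix \<open>\<Phi>\<close> applied to the indicator vector
  of \<open>T\<close>.\<close>

definition colsum :: "'a set \<Rightarrow> 'b \<Rightarrow> int" where
  "colsum T r = (\<Sum>w\<in>T. \<Phi> r w)"

text \<open>The minor is linear in its second column and trivially zero when both columns are
  \<open>v\<close>, so the second column may be a sum over any part of the closed star.\<close>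

lemma minor_star:
  assumes "v \<in> A" "T \<subseteq> star E A v" "u \<in> B" "t \<in> B" "u \<noteq> t" "\<not> E' u t"
  shows "\<Phi> u v * colsum T t = \<Phi> t v * colsum T u"
  unfolding colsum_def sum_distrib_left
proof (rule sum.cong[OF refl])
  fix w assume "w \<in> T"
  then have "w \<in> A" "w = v \<or> E v w" using assms(2) by (auto simp: star_def)
  then show "\<Phi> u v * \<Phi> t w = \<Phi> t v * \<Phi> u w"
    using minor[of v w u t] assms by (elim disjE) simp_all
qed

text \<open>As \<open>\<Phi> u v\<close> is odd, the vanishing minor can be solved for row
  \<open>r\<close> modulo 2: outside the star of \<open>u\<close>, the image of \<open>T\<close> is
  dictated by its parity in row \<open>u\<close>.\<close>

lemma parity_outside_star:
  assumes "v \<in> A" "T \<subseteq> star E A v" "u \<in> B" "odd (\<Phi> u v)" "r \<in> B" "r \<notin> star E' B u"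
  shows "odd (colsum T r) \<longleftrightarrow> odd (\<Phi> r v) \<and> odd (colsum T u)"
proof -
  have "\<Phi> u v * colsum T r = \<Phi> r v * colsum T u"
    using assms by (intro minor_star) (auto simp: star_def)
  then have "odd (\<Phi> u v * colsum T r) \<longleftrightarrow> odd (\<Phi> r v * colsum T u)" by simp
  then show ?thesis using assms by simp
qed

text \<open>The odd support of the image of \<open>T\<close>, cut down to the star of
  \<open>u\<close>; not a matrix trace.\<close>

definition trace :: "'b \<Rightarrow> 'a set \<Rightarrow> 'b set" where
  "trace u T = {r \<in> star E' B u. odd (colsum T r)}"

text \<open>Applying the left inverse \<open>\<Psi>\<close> modulo 2 to the image of an indicator
  vector returns that vector.\<close>

lemma parity_recovers:
  assumes "T \<subseteq> A" "w \<in> A"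
  shows "w \<in> T \<longleftrightarrow> odd (\<Sum>r\<in>B. \<Psi> w r * colsum T r)"
proof -
  have finX: "finite T" using assms fin finite_subset by blast
  have "(\<Sum>r\<in>B. \<Psi> w r * colsum T r) = (\<Sum>x\<in>T. \<Sum>r\<in>B. \<Psi> w r * \<Phi> r x)"
    unfolding colsum_def sum_distrib_left by (rule sum.swap)
  moreover have "[(\<Sum>x\<in>T. \<Sum>r\<in>B. \<Psi> w r * \<Phi> r x) = (\<Sum>x\<in>T. of_bool (w = x))] (mod 2)"
    using assms by (intro cong_sum linv) auto
  moreover have "(\<Sum>x\<in>T. of_bool (w = x) :: int) = of_bool (w \<in> T)"
    using finX by (simp add: of_bool_def)
  ultimately have "[(\<Sum>r\<in>B. \<Psi> w r * colsum T r) = of_bool (w \<in> T)] (mod 2)"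
    by simp
  then have "even (\<Sum>r\<in>B. \<Psi> w r * colsum T r) \<longleftrightarrow> even (of_bool (w \<in> T) :: int)"
    by (rule cong_dvd_iff)
  then show ?thesis by (cases "w \<in> T") auto
qed

text \<open>The parities in the star of \<open>u\<close> determine those outside it by
  \<open>parity_outside_star\<close>, and all parities together determine the subset. Counting
  subsets will compare the sizes of the two stars.\<close>

lemma inj_on_trace:
  assumes "v \<in> A" "u \<in> B" "odd (\<Phi> u v)"
  shows "inj_on (trace u) (Pow (star E A v))"
proof (rule inj_onI)
  fix T U assume TU: "T \<in> Pow (star E A v)" "U \<in> Pow (star E A v)" "trace u T = trace u U"
  have *: "odd (colsum T r) \<longleftrightarrow> odd (colsum U r)" if "r \<in> star E' B u" for r
    using TU(3) that by (auto simp: trace_def)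
  have par: "odd (colsum T r) \<longleftrightarrow> odd (colsum U r)" if "r \<in> B" for r
  proof (cases "r \<in> star E' B u")
    case False
    have "u \<in> star E' B u" using assms by (simp add: star_def)
    then show ?thesis
      using parity_outside_star[OF assms(1) _ assms(2,3) that False] TU * by auto
  qed (simp add: *)
  have "odd (\<Sum>r\<in>B. \<Psi> w r * colsum T r) \<longleftrightarrow> odd (\<Sum>r\<in>B. \<Psi> w r * colsum U r)" for w
  proof -
    have "even (\<Sum>r\<in>B. \<Psi> w r * colsum T r - \<Psi> w r * colsum U r)"
      using par by (intro dvd_sum) auto
    then show ?thesis by (simp add: sum_subtractf)
  qed
  moreover have "T \<subseteq> A" "U \<subseteq> A" using TU by (auto simp: star_def)
  ultimately show "T = U"
    using parity_recovers by blast
qed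

lemma trace_subset: "trace u ` Pow (star E A v) \<subseteq> Pow (star E' B u)"
  by (auto simp: trace_def)

lemma finite_star: "finite (star E A v)" "finite (star E' B u)"
  using fin by (auto simp: star_def)

lemma card_star_le:
  assumes "v \<in> A" "u \<in> B" "odd (\<Phi> u v)"
  shows "card (star E A v) \<le> card (star E' B u)"
proof -
  have "card (Pow (star E A v)) \<le> card (Pow (star E' B u))"
    by (rule card_inj_on_le[OF inj_on_trace[OF assms] trace_subset])
      (simp add: finite_star)
  then show ?thesis by (simp add: card_Pow finite_star)
qed

text \<open>Equal star sizes make the injection \<open>trace u\<close> surjective, so some
  \<open>T\<close> has trace \<open>{s}\<close>. Its image is odd in row \<open>s\<close> and even
  in row \<open>u\<close>, hence even in row \<open>t\<close>, which lies outside the star of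
  \<open>u\<close>. If \<open>s\<close> and \<open>t\<close> were not adjacent, the minor of these
  two rows would equate an even with an odd number.\<close>

lemma link_subset:
  assumes v: "v \<in> A" and u: "u \<in> B" "odd (\<Phi> u v)"
    and card: "card (star E A v) = card (star E' B u)"
    and t: "t \<in> B" "t \<notin> star E' B u" "odd (\<Phi> t v)"
    and irr': "\<not> E' u u"
  shows "link E' B u \<subseteq> link E' B t"
proof
  fix s assume s: "s \<in> link E' B u"
  then have sB: "s \<in> B" and "s \<noteq> u" and s_st: "s \<in> star E' B u"
    using irr' by (auto simp: link_def star_def)
  have "trace u ` Pow (star E A v) = Pow (star E' B u)"
    using inj_on_trace[OF v u]
    by (intro card_subset_eq trace_subset) (simp_all add: finite_star card_image card_Pow card)
  then obtain T where T: "T \<subseteq> star E A v" "trace u T = {s}"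
    using s_st by (metis (no_types, lifting) PowD PowI empty_subsetI image_iff insert_subset)
  have odd_s: "odd (colsum T s)" using T by (auto simp: trace_def)
  have "u \<in> star E' B u" using u by (simp add: star_def)
  then have "even (colsum T u)" using T \<open>s \<noteq> u\<close> by (auto simp: trace_def)
  then have even_t: "even (colsum T t)"
    using parity_outside_star[OF v T(1) u t(1,2)] by simp
  have "s \<noteq> t" using s_st t by auto
  have "E' s t"
  proof (rule ccontr)
    assume "\<not> E' s t"
    then have "\<Phi> s v * colsum T t = \<Phi> t v * colsum T s"
      using minor_star[OF v T(1) sB t(1) \<open>s \<noteq> t\<close>] by simp
    moreover have "odd (\<Phi> t v * colsum T s)" using odd_s t by simp
    ultimately show False using even_t by (metis dvd_mult)
  qed
  then show "s \<in> link E' B t" using sB t sym by (auto simp: link_def)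
qed

lemma card_eq: "card A = card B"
proof (rule antisym)
  show "card A \<le> card B"
    by (rule right_invertible_mod_card_le[OF fin(2,1) _ linv]) simp_all
  show "card B \<le> card A"
    by (rule right_invertible_mod_card_le[OF fin _ rinv]) simp_all
qed

text \<open>Distinct rows with equal links are not adjacent, because no vertex lies in its own link.
  So \<open>minor\<close> makes the columns of two adjacent vertices proportional on every class of
  rows with a common link, as the cancellation requires.\<close>

lemma transversal:
  assumes irr': "\<And>u. u \<in> B \<Longrightarrow> \<not> E' u u"
  obtains \<sigma> where "bij_betw \<sigma> A B" "\<And>v. v \<in> A \<Longrightarrow> odd (\<Phi> (\<sigma> v) v)"
    "\<And>v w. \<lbrakk>v \<in> A; w \<in> A; E v w\<rbrakk> \<Longrightarrow> link E' B (\<sigma> v) \<noteq> link E' B (\<sigma> w)"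
proof (rule invertible_mod_transversal[of A B 2 \<Phi> \<Psi> E "link E' B"])
  fix v w r s
  assume *: "v \<in> A" "w \<in> A" "E v w" "r \<in> B" "s \<in> B" "link E' B r = link E' B s"
  show "[\<Phi> r v * \<Phi> s w = \<Phi> s v * \<Phi> r w] (mod 2)"
  proof (cases "r = s")
    case False
    have "\<not> E' r s" using * irr' by (auto simp: link_def)
    then show ?thesis using minor[OF *(1-5) False] by simp
  qed simp
next
  show "[(\<Sum>v\<in>A. \<Phi> u v * \<Psi> v w) = of_bool (u = w)] (mod 2)" if "u \<in> B" "w \<in> B" for u w
    using rinv that .
next
  show "card A \<le> card B" using card_eq by simp
next
  show "\<not> is_unit (2 :: int)" by simp
next
  fix \<sigma> assume "bij_betw \<sigma> A B" "\<And>v. v \<in> A \<Longrightarrow> odd (\<Phi> (\<sigma> v) v)"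
    "\<And>v w. \<lbrakk>v \<in> A; w \<in> A; E v w\<rbrakk> \<Longrightarrow> link E' B (\<sigma> v) \<noteq> link E' B (\<sigma> w)"
  then show thesis by (rule that)
qed (use fin irr in blast)+

end

text \<open>Star sizes decrease neither along \<open>\<sigma>\<close> nor along
  \<open>\<rho>\<close>, so the totals agree and every single size is kept. If an edge went to a
  non-adjacent pair, the vanishing minor would make the two crossed entries odd as well;
  \<open>link_subset\<close> in both directions would then give equal links, which the choice of
  \<open>\<sigma>\<close> excludes.\<close>

lemma parity_graph_morphism:
  fixes \<Phi> :: "'b \<Rightarrow> 'a \<Rightarrow> int" and \<Psi> :: "'a \<Rightarrow> 'b \<Rightarrow> int"
  assumes "parity_map A B E E' \<Phi> \<Psi>" "parity_map B A E' E \<Psi> \<Phi>"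
  obtains \<sigma> where "bij_betw \<sigma> A B" "\<And>v. v \<in> A \<Longrightarrow> odd (\<Phi> (\<sigma> v) v)"
    "\<And>v w. \<lbrakk>v \<in> A; w \<in> A; E v w\<rbrakk> \<Longrightarrow> E' (\<sigma> v) (\<sigma> w)"
proof -
  interpret f: parity_map A B E E' \<Phi> \<Psi> by fact
  interpret g: parity_map B A E' E \<Psi> \<Phi> by fact
  let ?d = "\<lambda>v. card (star E A v)" and ?d' = "\<lambda>u. card (star E' B u)"
  obtain \<sigma> where \<sigma>: "bij_betw \<sigma> A B" "\<And>v. v \<in> A \<Longrightarrow> odd (\<Phi> (\<sigma> v) v)"
    "\<And>v w. \<lbrakk>v \<in> A; w \<in> A; E v w\<rbrakk> \<Longrightarrow> link E' B (\<sigma> v) \<noteq> link E' B (\<sigma> w)"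
    using f.transversal[OF g.irr] by metis
  \<comment> \<open>\<open>\<rho>\<close> need not be inverse to \<open>\<sigma>\<close>; it only
    bounds the total of the star sizes from the other side.\<close>
  obtain \<rho> where \<rho>: "bij_betw \<rho> B A" "\<And>u. u \<in> B \<Longrightarrow> odd (\<Psi> (\<rho> u) u)"
    using g.transversal[OF f.irr] by metis
  have \<sigma>B: "\<sigma> v \<in> B" if "v \<in> A" for v using \<sigma>(1) that by (auto simp: bij_betw_def)
  have \<rho>A: "\<rho> u \<in> A" if "u \<in> B" for u using \<rho>(1) that by (auto simp: bij_betw_def)
  have le: "?d v \<le> ?d' (\<sigma> v)" if "v \<in> A" for v
    using f.card_star_le \<sigma> \<sigma>B that by blast
  have "(\<Sum>v\<in>A. ?d' (\<sigma> v)) = (\<Sum>u\<in>B. ?d' u)"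
    by (rule sum.reindex_bij_betw[OF \<sigma>(1)])
  also have "\<dots> \<le> (\<Sum>u\<in>B. ?d (\<rho> u))"
    using g.card_star_le \<rho> \<rho>A by (intro sum_mono) blast
  also have "\<dots> = (\<Sum>v\<in>A. ?d v)"
    by (rule sum.reindex_bij_betw[OF \<rho>(1)])
  finally have sum_le: "(\<Sum>v\<in>A. ?d' (\<sigma> v)) \<le> (\<Sum>v\<in>A. ?d v)" .
  have eq: "?d v = ?d' (\<sigma> v)" if "v \<in> A" for v
  proof (rule ccontr)
    assume "?d v \<noteq> ?d' (\<sigma> v)"
    then have "?d v < ?d' (\<sigma> v)" using le[OF that] by simp
    then have "(\<Sum>v\<in>A. ?d v) < (\<Sum>v\<in>A. ?d' (\<sigma> v))"
      using f.fin le that by (intro sum_strict_mono_ex1) auto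
    then show False using sum_le by simp
  qed
  have "E' (\<sigma> v) (\<sigma> w)" if vw: "v \<in> A" "w \<in> A" "E v w" for v w
  proof (rule ccontr)
    assume non: "\<not> E' (\<sigma> v) (\<sigma> w)"
    have ne: "\<sigma> v \<noteq> \<sigma> w"
      using \<sigma>(3)[OF vw] by auto
    have non': "\<not> E' (\<sigma> w) (\<sigma> v)" using non f.sym \<sigma>B vw by blast
    have "\<Phi> (\<sigma> v) v * \<Phi> (\<sigma> w) w = \<Phi> (\<sigma> w) v * \<Phi> (\<sigma> v) w"
      using f.minor[OF vw _ _ ne non] \<sigma>B vw by blast
    moreover have "odd (\<Phi> (\<sigma> v) v * \<Phi> (\<sigma> w) w)" using \<sigma>(2) vw by simp
    ultimately have "odd (\<Phi> (\<sigma> w) v * \<Phi> (\<sigma> v) w)" by simp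
    then have odds: "odd (\<Phi> (\<sigma> w) v)" "odd (\<Phi> (\<sigma> v) w)" by simp_all
    have "link E' B (\<sigma> v) \<subseteq> link E' B (\<sigma> w)"
      using f.link_subset[OF vw(1) \<sigma>B[OF vw(1)] \<sigma>(2)[OF vw(1)] eq[OF vw(1)] \<sigma>B[OF vw(2)] _ odds(1)
        g.irr[OF \<sigma>B[OF vw(1)]]] non ne by (auto simp: star_def)
    moreover have "link E' B (\<sigma> w) \<subseteq> link E' B (\<sigma> v)"
      using f.link_subset[OF vw(2) \<sigma>B[OF vw(2)] \<sigma>(2)[OF vw(2)] eq[OF vw(2)] \<sigma>B[OF vw(1)] _ odds(2)
        g.irr[OF \<sigma>B[OF vw(2)]]] non' ne by (auto simp: star_def)
    ultimately show False using \<sigma>(3)[OF vw] by blast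
  qed
  then show thesis using that \<sigma> by blast
qed

section \<open>Words over cyclic vertex groups\<close>

text \<open>Provides a faithful character of the cyclic group of order \<open>n\<close>, so that
  complex matrices can detect whether an exponent is trivial.\<close>

lemma primitive_root_of_unity:
  assumes "n > 0"
  obtains z :: complex where "z \<noteq> 0" "\<And>k::int. z powi k = 1 \<longleftrightarrow> int n dvd k"
proof
  let ?z = "cis (2 * pi / real n)"
  show "?z \<noteq> 0" by simp
  fix k :: int
  have "?z powi k = 1 \<longleftrightarrow> cos (of_int k * (2 * pi / real n)) = 1 \<and> sin (of_int k * (2 * pi / real n)) = 0"
    by (simp add: cis_power_int complex_eq_iff)
  also have "\<dots> \<longleftrightarrow> cos (of_int k * (2 * pi / real n)) = 1"
    by (metis cos_one_sin_zero)
  also have "\<dots> \<longleftrightarrow> (\<exists>j::int. of_int k * (2 * pi / real n) = of_int j * 2 * pi)"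
    by (rule cos_one_2pi_int)
  also have "\<dots> \<longleftrightarrow> (\<exists>j::int. of_int k = (of_int (int n * j) :: real))"
    using assms by (simp add: field_simps)
  also have "\<dots> \<longleftrightarrow> int n dvd k"
    unfolding of_int_eq_iff dvd_def ..
  finally show "?z powi k = 1 \<longleftrightarrow> int n dvd k" .
qed

text \<open>One eigenvalue \<open>l\<close> is an \<open>N\<close>-th root of unity, the other one
  is \<open>\<delta> / l\<close>. With the determinant fixed, only finitely many traces
  remain.\<close>

lemma finite_order_trace:
  fixes p q r s \<delta> :: complex
  assumes fin: "((\<lambda>(x, y). (p * x + q * y, r * x + s * y)) ^^ N) = id"
    and det: "p * s - q * r = \<delta>" "\<delta> \<noteq> 0"
  shows "p + s \<in> (\<lambda>l. l + \<delta> / l) ` {l. l ^ N = 1}"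
proof -
  define f where "f = (\<lambda>(x, y). (p * x + q * y, r * x + s * y))"
  define l where "l = (p + s + csqrt ((p + s)\<^sup>2 - 4 * \<delta>)) / 2"
  have "2 * l - (p + s) = csqrt ((p + s)\<^sup>2 - 4 * \<delta>)"
    unfolding l_def by (simp add: field_simps)
  then have "(2 * l - (p + s))\<^sup>2 = (p + s)\<^sup>2 - 4 * \<delta>"
    by (simp only: power2_csqrt)
  then have "4 * (l * l + \<delta>) = 4 * ((p + s) * l)"
    by (simp add: power2_eq_square algebra_simps)
  then have char: "l * l + \<delta> = (p + s) * l"
    by (subst (asm) mult_cancel_left) simp
  then have "l \<noteq> 0" using det by auto
  have sing: "(p - l) * (s - l) = q * r"
    using char det by (simp add: algebra_simps)
  \<comment> \<open>A kernel vector of the singular matrix with rows \<open>(p - l, q)\<close> and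
    \<open>(r, s - l)\<close> is read off from a nonzero row; if both rows vanish, every vector is
    an eigenvector.\<close>
  have "\<exists>x y. (x, y) \<noteq> (0, 0) \<and> f (x, y) = (l * x, l * y)"
  proof (cases "q = 0 \<and> p = l")
    case False
    show ?thesis
      by (rule exI[of _ q], rule exI[of _ "l - p"])
        (use False sing in \<open>auto simp: f_def algebra_simps\<close>)
  next
    case True
    show ?thesis
    proof (cases "r = 0 \<and> s = l")
      case False
      show ?thesis
        by (rule exI[of _ "l - s"], rule exI[of _ r])
          (use False True in \<open>auto simp: f_def algebra_simps\<close>)
    next
      case r: True
      show ?thesis
        by (rule exI[of _ 1], rule exI[of _ 0]) (use True r in \<open>auto simp: f_def\<close>)
    qed
  qed
  then obtain x y where xy: "(x, y) \<noteq> (0, 0)" "f (x, y) = (l * x, l * y)" by blast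
  have lin: "f (c * a, c * b) = (c * fst (f (a, b)), c * snd (f (a, b)))" for c a b
    by (simp add: f_def algebra_simps)
  have "(f ^^ k) (x, y) = (l ^ k * x, l ^ k * y)" for k
    by (induction k) (simp_all add: lin xy(2) mult.assoc mult.left_commute)
  then have "(l ^ N * x, l ^ N * y) = (x, y)"
    using fin by (metis f_def id_apply)
  then have "l ^ N = 1" using xy(1) by auto
  moreover have "p + s = l + \<delta> / l"
    using char \<open>l \<noteq> 0\<close> by (simp add: field_simps)
  ultimately show ?thesis by blast
qed

locale cyclic_graph_product =
  fixes V :: "'a set" and E :: "'a \<Rightarrow> 'a \<Rightarrow> bool" and G :: "'a \<Rightarrow> ('g, 'c) monoid_scheme"
  assumes labeled: "labeled_graph V E G"
    and cyclic: "\<And>v. v \<in> V \<Longrightarrow> dir_indec_cyclic (G v)"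
begin

lemma finV: "finite V" and E_sym: "\<lbrakk>u \<in> V; v \<in> V; E u v\<rbrakk> \<Longrightarrow> E v u"
  and E_irr: "v \<in> V \<Longrightarrow> \<not> E v v" and grp: "v \<in> V \<Longrightarrow> group (G v)"
  and nontriv: "v \<in> V \<Longrightarrow> carrier (G v) \<noteq> {\<one>\<^bsub>G v\<^esub>}"
  using labeled by (auto simp: labeled_graph_def)

section \<open>Discrete logarithms in the vertex groups and exponent sums of words\<close>

definition gen :: "'a \<Rightarrow> 'g" where
  "gen v = (SOME g. g \<in> carrier (G v) \<and> carrier (G v) = range (\<lambda>k::int. g [^]\<^bsub>G v\<^esub> k))"

text \<open>The order of the vertex group, with \<open>0\<close> standing for an infinite group.\<close>
definition vord :: "'a \<Rightarrow> nat" where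
  "vord v = group.ord (G v) (gen v)"

text \<open>A discrete logarithm, meaningful only modulo \<open>vord v\<close>. Statements about
  exponents are therefore congruences, which become equalities of integers at infinite
  vertices.\<close>

definition lg :: "'a \<Rightarrow> 'g \<Rightarrow> int" where
  "lg v g = (SOME k. gen v [^]\<^bsub>G v\<^esub> k = g)"

lemma gen: assumes "v \<in> V"
  shows gen_closed: "gen v \<in> carrier (G v)"
    and gen_range: "carrier (G v) = range (\<lambda>k::int. gen v [^]\<^bsub>G v\<^esub> k)"
proof -
  interpret group "G v" by (rule grp[OF assms])
  have "\<exists>g. g \<in> carrier (G v) \<and> carrier (G v) = range (\<lambda>k::int. g [^]\<^bsub>G v\<^esub> k)"
    using cyclic[OF assms] unfolding dir_indec_cyclic_def cyclic_group by blast
  from someI_ex[OF this] show "gen v \<in> carrier (G v)"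
    "carrier (G v) = range (\<lambda>k::int. gen v [^]\<^bsub>G v\<^esub> k)"
    unfolding gen_def by simp_all
qed

lemma pow_lg: assumes "v \<in> V" "g \<in> carrier (G v)" shows "gen v [^]\<^bsub>G v\<^esub> lg v g = g"
proof -
  have "\<exists>k::int. gen v [^]\<^bsub>G v\<^esub> k = g"
    using gen_range[OF assms(1)] assms(2) by auto
  then show ?thesis unfolding lg_def by (rule someI_ex)
qed

lemma gen_pow_closed: "v \<in> V \<Longrightarrow> gen v [^]\<^bsub>G v\<^esub> (k::int) \<in> carrier (G v)"
  using gen_range by auto

lemma pow_eq_iff:
  assumes "v \<in> V"
  shows "gen v [^]\<^bsub>G v\<^esub> (j::int) = gen v [^]\<^bsub>G v\<^esub> k \<longleftrightarrow> [j = k] (mod int (vord v))"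
proof -
  interpret group "G v" by (rule grp[OF assms])
  show ?thesis
    using int_pow_eq[OF gen_closed[OF assms]] 
    by (simp add: vord_def cong_iff_dvd_diff dvd_diff_commute)
qed

lemma lg_pow: assumes "v \<in> V" shows "[lg v (gen v [^]\<^bsub>G v\<^esub> k) = k] (mod int (vord v))"
  using pow_lg[OF assms gen_pow_closed[OF assms]] pow_eq_iff[OF assms] by blast

lemma lg_mult:
  assumes "v \<in> V" "g \<in> carrier (G v)" "h \<in> carrier (G v)"
  shows "[lg v (g \<otimes>\<^bsub>G v\<^esub> h) = lg v g + lg v h] (mod int (vord v))"
proof -
  interpret group "G v" by (rule grp[OF assms(1)])
  have "gen v [^]\<^bsub>G v\<^esub> (lg v g + lg v h) = g \<otimes>\<^bsub>G v\<^esub> h"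
    using assms gen_closed by (simp add: int_pow_mult pow_lg)
  then show ?thesis
    using lg_pow[OF assms(1), of "lg v g + lg v h"] by simp
qed

lemma lg_one: assumes "v \<in> V" shows "[lg v \<one>\<^bsub>G v\<^esub> = 0] (mod int (vord v))"
proof -
  interpret group "G v" by (rule grp[OF assms])
  show ?thesis using lg_pow[OF assms, of 0] by simp
qed

lemma vord_cases:
  assumes "v \<in> V"
  obtains "vord v = 0" | p k where "Factorial_Ring.prime (p::nat)" "k > 0" "vord v = p ^ k"
proof -
  interpret group "G v" by (rule grp[OF assms])
  have c: "gen v \<in> carrier (G v)" and r: "carrier (G v) = range (\<lambda>k::int. gen v [^]\<^bsub>G v\<^esub> k)"
    by (rule gen_closed[OF assms], rule gen_range[OF assms])
  have "generate (G v) {gen v} = carrier (G v)"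
    using generate_pow[OF c] r by auto
  then have card: "vord v = card (carrier (G v))"
    unfolding vord_def using generate_pow_card[OF c] by simp
  have "vord v \<noteq> 1"
  proof
    assume "vord v = 1"
    then have "gen v = \<one>\<^bsub>G v\<^esub>" using ord_eq_1[OF c] by (simp add: vord_def)
    then show False using r nontriv[OF assms] by auto
  qed
  then show thesis
    using cyclic[OF assms] card that unfolding dir_indec_cyclic_def
    by (metis card.infinite gr0I power_0)
qed

abbreviation R :: "('a \<times> 'g) list \<Rightarrow> ('a \<times> 'g) list \<Rightarrow> bool" where
  "R \<equiv> gp_rel V E G"

text \<open>The retraction of the graph product onto the vertex group at \<open>v\<close>, written
  additively.\<close>

definition ex :: "'a \<Rightarrow> ('a \<times> 'g) list \<Rightarrow> int" where
  "ex v w = (\<Sum>(u, g)\<leftarrow>w. if u = v then lg v g else 0)"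

lemma ex_simps [simp]: "ex v [] = 0" "ex v ((u, g) # w) = (if u = v then lg v g else 0) + ex v w"
  "ex v (x @ y) = ex v x + ex v y"
  by (simp_all add: ex_def)

lemma ex_cong: "R w w' \<Longrightarrow> v \<in> V \<Longrightarrow> [ex v w = ex v w'] (mod int (vord v))"
proof (induction rule: gp_rel.induct)
  case (gp_mult u g h)
  then show ?case using lg_mult[of u g h] by (auto simp: cong_sym_eq)
next
  case (gp_one u)
  then show ?case using lg_one[of u] by auto
next
  case (gp_trans w w' w'')
  then show ?case using cong_trans by blast
next
  case (gp_ctxt w w' xs ys)
  then have "[ex v w = ex v w'] (mod int (vord v))" by blast
  then show ?case unfolding ex_simps by (intro cong_add cong_refl)
qed (simp_all add: cong_sym_eq add.commute)

text \<open>A prospective action of the graph product, in which \<open>A v k\<close> is the effect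
  of the \<open>k\<close>-th power of the generator at \<open>v\<close>. It is defined on words and
  still has to respect the relations.\<close>

definition act :: "('a \<Rightarrow> int \<Rightarrow> 's \<Rightarrow> 's) \<Rightarrow> ('a \<times> 'g) list \<Rightarrow> 's \<Rightarrow> 's" where
  "act A w = foldr (\<lambda>(v, g) f. A v (lg v g) \<circ> f) w id"

lemma act_simps [simp]: "act A [] = id" "act A ((v, g) # w) = A v (lg v g) \<circ> act A w"
  by (simp_all add: act_def)

lemma act_append [simp]: "act A (x @ y) = act A x \<circ> act A y"
  by (induction x) (auto simp: comp_assoc)

text \<open>Additivity and \<open>ord\<close> make \<open>A v k\<close> depend only on
  \<open>k\<close> modulo \<open>vord v\<close>, which is all that \<open>lg\<close> knows about
  products. The defining relations then hold letter by letter.\<close>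

lemma act_cong:
  assumes add: "\<And>v j k. v \<in> V \<Longrightarrow> A v (j + k) = A v j \<circ> A v k"
    and zero: "\<And>v. v \<in> V \<Longrightarrow> A v 0 = id"
    and ord: "\<And>v. v \<in> V \<Longrightarrow> A v (int (vord v)) = id"
    and comm: "\<And>u v j k. \<lbrakk>u \<in> V; v \<in> V; E u v\<rbrakk> \<Longrightarrow> A u j \<circ> A v k = A v k \<circ> A u j"
    and "R w w'"
  shows "act A w = act A w'"
proof -
  have mult: "A v (int (vord v) * int c) = id" if "v \<in> V" for v c
    by (induction c) (simp_all add: zero ord add that distrib_left)
  have mult': "A v (int (vord v) * c) = id" if v: "v \<in> V" for v c
  proof (cases c)
    case (neg m)
    have "int (vord v) * c + int (vord v) * int (Suc m) = 0"
      unfolding neg by (simp add: algebra_simps)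
    then have "id = A v (int (vord v) * c) \<circ> A v (int (vord v) * int (Suc m))"
      using add[OF v, of "int (vord v) * c" "int (vord v) * int (Suc m)"] zero[OF v] by (simp only:)
    then show ?thesis unfolding mult[OF v] by simp
  qed (simp add: mult[OF v])
  have cong: "A v j = A v k" if v: "v \<in> V" and "[j = k] (mod int (vord v))" for v j k
  proof -
    have "int (vord v) dvd j - k" using that by (simp add: cong_iff_dvd_diff)
    then obtain c where "j - k = int (vord v) * c" by (rule dvdE)
    then have "j = k + int (vord v) * c" by simp
    then show ?thesis by (simp only: add[OF v] mult'[OF v] comp_id)
  qed
  from \<open>R w w'\<close> show ?thesis
  proof (induction rule: gp_rel.induct)
    case (gp_mult v g h)
    then have "A v (lg v (g \<otimes>\<^bsub>G v\<^esub> h)) = A v (lg v g) \<circ> A v (lg v h)"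
      using cong[OF gp_mult(1) lg_mult[OF gp_mult]] by (simp only: add[OF gp_mult(1)])
    then show ?case by simp
  next
    case (gp_one v)
    then have "A v (lg v \<one>\<^bsub>G v\<^esub>) = id"
      using cong[OF gp_one lg_one[OF gp_one]] by (simp only: zero[OF gp_one])
    then show ?case by simp
  next
    case (gp_comm u v g h)
    then show ?case by (simp only: act_simps comp_id comm[OF gp_comm(1-3)])
  qed auto
qed

section \<open>Commuting words and torsion words\<close>

definition commute :: "('a \<times> 'g) list \<Rightarrow> ('a \<times> 'g) list \<Rightarrow> bool" where
  "commute x y \<longleftrightarrow> R (x @ y) (y @ x)"

definition wpow :: "nat \<Rightarrow> ('a \<times> 'g) list \<Rightarrow> ('a \<times> 'g) list" where
  "wpow N x = concat (replicate N x)"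

definition torsion :: "('a \<times> 'g) list \<Rightarrow> bool" where
  "torsion x \<longleftrightarrow> (\<exists>N>0. R (wpow N x) [])"

lemma wpow_simps [simp]: "wpow 0 x = []" "wpow (Suc N) x = x @ wpow N x"
  by (simp_all add: wpow_def)

lemma act_wpow: "act A (wpow N x) = act A x ^^ N"
  by (induction N) auto

lemma ex_wpow: "ex v (wpow N x) = int N * ex v x"
  by (induction N) (auto simp: algebra_simps)

lemma R_append: "R x x' \<Longrightarrow> R y y' \<Longrightarrow> R (x @ y) (x' @ y')"
  using gp_ctxt[of V E G x x' "[]" y] gp_ctxt[of V E G y y' x' "[]"]
    gp_trans[of V E G "x @ y" "x' @ y" "x' @ y'"] by simp

lemma commute_wpow: "commute x y \<Longrightarrow> R (x @ wpow N y) (wpow N y @ x)"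
proof (induction N)
  case (Suc N)
  have "R ((x @ y) @ wpow N y) ((y @ x) @ wpow N y)"
    using Suc.prems unfolding commute_def by (rule R_append[OF _ gp_refl])
  moreover have "R (y @ (x @ wpow N y)) (y @ (wpow N y @ x))"
    by (rule R_append[OF gp_refl Suc.IH[OF Suc.prems]])
  ultimately show ?case using gp_trans[of V E G] by (simp only: wpow_simps append_assoc)
qed (simp add: gp_refl)

lemma wpow_append: "commute x y \<Longrightarrow> R (wpow N (x @ y)) (wpow N x @ wpow N y)"
proof (induction N)
  case (Suc N)
  have "commute y x" using Suc by (simp add: commute_def gp_sym)
  have "R ((x @ y) @ wpow N (x @ y)) ((x @ y) @ (wpow N x @ wpow N y))"
    by (rule R_append[OF gp_refl Suc.IH[OF Suc.prems]])
  moreover have "R (x @ (y @ wpow N x) @ wpow N y) (x @ (wpow N x @ y) @ wpow N y)"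
    by (rule R_append[OF gp_refl R_append[OF commute_wpow[OF \<open>commute y x\<close>] gp_refl]])
  ultimately show ?case using gp_trans[of V E G] by (simp only: wpow_simps append_assoc)
qed (simp add: gp_refl)

lemma wpow_mult: "R (wpow N x) [] \<Longrightarrow> R (wpow (k * N) x) []"
proof (induction k)
  case (Suc k)
  have "wpow (Suc k * N) x = wpow N x @ wpow (k * N) x"
    by (simp add: wpow_def replicate_add)
  then show ?case using R_append[of "wpow N x" "[]" "wpow (k * N) x" "[]"] Suc by simp
qed (simp add: gp_refl)

lemma torsion_append:
  assumes "commute x y" "torsion x" "torsion y"
  shows "torsion (x @ y)"
proof -
  obtain N M where NM: "N > 0" "M > 0" "R (wpow N x) []" "R (wpow M y) []"
    using assms by (auto simp: torsion_def)
  have "R (wpow (N * M) x @ wpow (N * M) y) ([] @ [])"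
    using wpow_mult[OF NM(3), of M] wpow_mult[OF NM(4), of N]
    by (intro R_append) (simp_all add: mult.commute)
  then have "R (wpow (N * M) (x @ y)) []"
    using gp_trans[OF wpow_append[OF assms(1)]] by simp
  then show ?thesis using NM by (auto simp: torsion_def intro!: exI[of _ "N * M"])
qed

lemma torsion_ex_infinite:
  assumes "torsion x" "v \<in> V" "vord v = 0"
  shows "ex v x = 0"
proof -
  obtain N where "N > 0" "R (wpow N x) []" using assms by (auto simp: torsion_def)
  then show ?thesis using ex_cong[of "wpow N x" "[]" v] assms by (simp add: ex_wpow)
qed

end

section \<open>Representations detecting non-adjacency\<close>

context cyclic_graph_product
begin

text \<open>The generator at \<open>a\<close> shears the plane and the one at \<open>b\<close>
  translates it; together they generate the Heisenberg group, and all other vertices act trivially.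
  An element acts as a unitriangular 3x3 matrix with its two exponents above the diagonal, and two
  such matrices commute only if the 2x2 determinant of these exponents is zero.\<close>

lemma heisenberg_action:
  assumes ab: "a \<in> V" "b \<in> V" "a \<noteq> b" "\<not> E a b" and inf: "vord a = 0" "vord b = 0"
    and comm: "commute x y"
  shows "ex a x * ex b y = ex a y * ex b x"
proof -
  define A :: "'a \<Rightarrow> int \<Rightarrow> int \<times> int \<Rightarrow> int \<times> int" where
    "A v k = (if v = a then \<lambda>(s, t). (s + k * t, t) else if v = b then \<lambda>(s, t). (s, t + k) else id)"
    for v k
  have Eba: "\<not> E b a" using E_sym ab by blast
  have cong: "act A w = act A w'" if "R w w'" for w w'
  proof (rule act_cong[OF _ _ _ _ that])
    show "A v (j + k) = A v j \<circ> A v k" for v j k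
      by (auto simp: A_def fun_eq_iff algebra_simps)
    show "A v 0 = id" for v
      by (auto simp: A_def fun_eq_iff)
    show "A v (int (vord v)) = id" for v
      using inf by (auto simp: A_def fun_eq_iff)
    show "A u j \<circ> A v k = A v k \<circ> A u j" if "u \<in> V" "v \<in> V" "E u v" for u v j k
      using that ab Eba E_irr by (auto simp: A_def fun_eq_iff)
  qed
  \<comment> \<open>The corner entry \<open>c\<close> depends on the order of the letters, but it
    cancels when \<open>x @ y\<close> is compared with \<open>y @ x\<close>.\<close>
  have shape: "\<exists>c. act A w = (\<lambda>(s, t). (s + ex a w * t + c, t + ex b w))" for w
  proof (induction w)
    case Nil
    show ?case by (auto simp: fun_eq_iff)
  next
    case (Cons ug w)
    obtain u g where ug: "ug = (u, g)" by (cases ug)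
    define k where "k = lg u g"
    have act: "act A (ug # w) = A u k \<circ> act A w"
      and ex: "\<And>v. ex v (ug # w) = (if u = v then k else 0) + ex v w"
      by (simp_all add: ug k_def)
    obtain c where c: "act A w = (\<lambda>(s, t). (s + ex a w * t + c, t + ex b w))"
      using Cons.IH by blast
    show ?case
    proof (cases "u = a")
      case True
      then have "A u k = (\<lambda>(s, t). (s + k * t, t))" by (simp add: A_def)
      then show ?thesis
        unfolding act ex c using ab True
        by (intro exI[of _ "c + k * ex b w"]) (auto simp: fun_eq_iff algebra_simps)
    next
      case False
      then have "A u k = (if u = b then \<lambda>(s, t). (s, t + k) else id)" by (simp add: A_def)
      then show ?thesis
        unfolding act ex c using False by (intro exI[of _ c]) (auto simp: fun_eq_iff)
    qed
  qed
  obtain c where c: "act A x = (\<lambda>(s, t). (s + ex a x * t + c, t + ex b x))"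
    using shape by blast
  obtain d where d: "act A y = (\<lambda>(s, t). (s + ex a y * t + d, t + ex b y))"
    using shape by blast
  have "act A (x @ y) = act A (y @ x)"
    by (rule cong[OF comm[unfolded commute_def]])
  then have "(act A x \<circ> act A y) (0, 0) = (act A y \<circ> act A x) (0, 0)"
    by (simp only: act_append)
  then have "ex a x * ex b y + (c + d) = ex a y * ex b x + (c + d)"
    unfolding c d by (simp add: add_ac)
  then show ?thesis by (simp only: add_right_cancel)
qed

text \<open>In the wreath product of a finite cyclic group with the integers, acting on functions,
  \<open>a\<close> multiplies the value at 0 by a root of unity and \<open>b\<close> shifts. An
  element without shift is multiplication by some \<open>F\<close> that is 1 almost everywhere and
  whose values multiply to \<open>z powi ex a x\<close>. Commuting with a nontrivial shift makes
  \<open>F\<close> periodic, hence 1 everywhere.\<close>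

lemma wreath_action:
  assumes ab: "a \<in> V" "b \<in> V" "a \<noteq> b" "\<not> E a b" and fin: "vord a > 0" and inf: "vord b = 0"
    and comm: "commute x y" and x: "ex b x = 0" and y: "ex b y \<noteq> 0"
  shows "int (vord a) dvd ex a x"
proof -
  obtain z :: complex where z: "z \<noteq> 0" "\<And>k::int. z powi k = 1 \<longleftrightarrow> int (vord a) dvd k"
    using primitive_root_of_unity[OF fin] by metis
  define m :: "int \<Rightarrow> int \<Rightarrow> complex" where "m k i = (if i = 0 then z powi k else 1)" for k i
  define A :: "'a \<Rightarrow> int \<Rightarrow> (int \<Rightarrow> complex) \<Rightarrow> int \<Rightarrow> complex" where
    "A v k = (if v = a then \<lambda>f i. m k i * f i else if v = b then \<lambda>f i. f (i - k) else id)"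
    for v k
  have Aa: "A a k = (\<lambda>f i. m k i * f i)" and Ab: "A b k = (\<lambda>f i. f (i - k))" for k
    using ab by (simp_all add: A_def)
  have Eba: "\<not> E b a" using E_sym ab by blast
  have cong: "act A w = act A w'" if "R w w'" for w w'
  proof (rule act_cong[OF _ _ _ _ that])
    show "A v (j + k) = A v j \<circ> A v k" for v j k
      using z(1) by (auto simp: A_def m_def fun_eq_iff power_int_add algebra_simps)
    show "A v 0 = id" for v
      by (auto simp: A_def m_def fun_eq_iff)
    show "A v (int (vord v)) = id" for v
      using z(2)[of "int (vord a)"] inf by (auto simp: A_def m_def fun_eq_iff)
    show "A u j \<circ> A v k = A v k \<circ> A u j" if "u \<in> V" "v \<in> V" "E u v" for u v j k
      using that ab Eba E_irr by (auto simp: A_def fun_eq_iff)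
  qed
  \<comment> \<open>\<open>S\<close> is any finite set outside which the multiplier \<open>D\<close>
    is 1, so that \<open>prod D S\<close> is the product of all its values.\<close>
  have shape: "\<exists>D S. act A w = (\<lambda>f i. D i * f (i - ex b w)) \<and> (\<forall>i. D i \<noteq> 0) \<and>
      finite S \<and> (\<forall>i. i \<notin> S \<longrightarrow> D i = 1) \<and> prod D S = z powi ex a w" for w
  proof (induction w)
    case Nil
    show ?case
      by (intro exI[of _ "\<lambda>_. 1"] exI[of _ "{}"]) (auto simp: fun_eq_iff)
  next
    case (Cons ug w)
    obtain u g where ug: "ug = (u, g)" by (cases ug)
    define k where "k = lg u g"
    have act: "act A (ug # w) = A u k \<circ> act A w"
      and ex: "\<And>v. ex v (ug # w) = (if u = v then k else 0) + ex v w"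
      by (simp_all add: ug k_def)
    obtain D S where D: "act A w = (\<lambda>f i. D i * f (i - ex b w))" "\<And>i. D i \<noteq> 0"
      "finite S" "\<And>i. i \<notin> S \<Longrightarrow> D i = 1" "prod D S = z powi ex a w"
      using Cons.IH by blast
    consider "u = a" | "u = b" | "u \<noteq> a" "u \<noteq> b" by blast
    then show ?case
    proof cases
      case 1
      have "prod D (insert 0 S) = prod D S"
        using D by (intro prod.mono_neutral_right) auto
      moreover have "prod (m k) (insert 0 S) = prod (m k) {0}"
        using D by (intro prod.mono_neutral_right) (auto simp: m_def)
      ultimately have "(\<Prod>i\<in>insert 0 S. m k i * D i) = z powi (k + ex a w)"
        using D z by (simp add: prod.distrib m_def power_int_add)
      then show ?thesis
        unfolding act ex 1 Aa D(1) using ab D(2-4) z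
        by (intro exI[of _ "\<lambda>i. m k i * D i"] exI[of _ "insert 0 S"])
          (auto simp: fun_eq_iff m_def mult.assoc)
    next
      case 2
      have "(\<Prod>i\<in>(+) k ` S. D (i - k)) = prod D S"
        by (subst prod.reindex) auto
      moreover have "i \<notin> (+) k ` S \<Longrightarrow> D (i - k) = 1" for i
        using D(4)[of "i - k"] by (metis add_diff_cancel_left' diff_add_cancel add.commute image_eqI)
      ultimately show ?thesis
        unfolding act ex 2 Ab D(1) using ab D(2,3,5)
        by (intro exI[of _ "\<lambda>i. D (i - k)"] exI[of _ "(+) k ` S"])
          (auto simp: fun_eq_iff diff_diff_eq)
    next
      case 3
      then have "A u k = id" by (simp add: A_def)
      then show ?thesis
        unfolding act ex using 3 D by (intro exI[of _ D] exI[of _ S]) auto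
    qed
  qed
  obtain F S where F: "act A x = (\<lambda>f i. F i * f (i - ex b x))" "finite S"
    "\<And>i. i \<notin> S \<Longrightarrow> F i = 1" "prod F S = z powi ex a x"
    using shape[of x] by blast
  obtain D where D: "act A y = (\<lambda>f i. D i * f (i - ex b y))" "\<And>i. D i \<noteq> 0"
    using shape[of y] by blast
  have "act A (x @ y) = act A (y @ x)"
    by (rule cong[OF comm[unfolded commute_def]])
  \<comment> \<open>The constant function 1 is shift-invariant, so only the multipliers
    remain.\<close>
  then have "(act A x \<circ> act A y) (\<lambda>_. 1) i = (act A y \<circ> act A x) (\<lambda>_. 1) i" for i by simp
  then have *: "F i * D i = D i * F (i - ex b y)" for i
    unfolding F(1) D(1) x by simp
  have shift: "F i = F (i - ex b y)" for i
    using *[of i] D(2)[of i] by (simp add: mult.commute)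
  have "F i = 1" for i
  proof -
    have *: "F (i - int k * ex b y) = F i" for k
    proof (induction k)
      case (Suc k)
      then show ?case using shift[of "i - int k * ex b y"] by (simp add: algebra_simps)
    qed simp
    have "inj (\<lambda>k. i - int k * ex b y)" using y by (auto simp: inj_on_def)
    then have "infinite (range (\<lambda>k. i - int k * ex b y))"
      using finite_imageD by blast
    then obtain k where "i - int k * ex b y \<notin> S"
      using F(2) by (meson finite_subset image_subsetI)
    then show ?thesis using F(3) * by metis
  qed
  then have "z powi ex a x = 1" using F(4) by simp
  then show ?thesis using z by simp
qed

text \<open>The trace of a torsion element under the representations \<open>act (A t)\<close> below takes
  finitely many values, hence does not depend on \<open>t\<close>. At \<open>t = 0\<close> both vertex groups act
  diagonally, and at \<open>t = \<i>\<close> they have the common eigenvector \<open>(-\<i>, 1)\<close>; comparing the traces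
  gives \<open>1 + \<alpha> \<beta> = \<alpha> + \<beta>\<close>.\<close>
lemma torsion_nonadjacent:
  assumes ab: "a \<in> V" "b \<in> V" "a \<noteq> b" "\<not> E a b" and fin: "vord a > 0" "vord b > 0"
    and tors: "torsion x"
  shows "int (vord a) dvd ex a x \<or> int (vord b) dvd ex b x"
proof -
  obtain z :: complex where z: "z \<noteq> 0" "\<And>k::int. z powi k = 1 \<longleftrightarrow> int (vord a) dvd k"
    using primitive_root_of_unity[OF fin(1)] by metis
  obtain y :: complex where y: "y \<noteq> 0" "\<And>k::int. y powi k = 1 \<longleftrightarrow> int (vord b) dvd k"
    using primitive_root_of_unity[OF fin(2)] by metis
  \<comment> \<open>At \<open>a\<close> the vector (1, 0) is fixed and (-t, 1) has eigenvalue
    \<open>z powi k\<close>; at \<open>b\<close> the vector (1, t) is fixed and (0, 1) has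
    eigenvalue \<open>y powi k\<close>. The vectors (-t, 1) and (1, t) are parallel exactly when the
    square of t is -1, which is where the value \<open>\<i>\<close> comes from.\<close>
  define A :: "complex \<Rightarrow> 'a \<Rightarrow> int \<Rightarrow> complex \<times> complex \<Rightarrow> complex \<times> complex" where
    "A t v k = (if v = a then \<lambda>(r, s). (r + t * (1 - z powi k) * s, z powi k * s)
      else if v = b then \<lambda>(r, s). (r, t * (1 - y powi k) * r + y powi k * s) else id)"
    for t v k
  have Aa: "A t a k = (\<lambda>(r, s). (r + t * (1 - z powi k) * s, z powi k * s))"
    and Ab: "A t b k = (\<lambda>(r, s). (r, t * (1 - y powi k) * r + y powi k * s))" for t k
    using ab by (simp_all add: A_def)
  have Eba: "\<not> E b a" using E_sym ab by blast
  have cong: "act (A t) w = act (A t) w'" if "R w w'" for t w w'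
  proof (rule act_cong[OF _ _ _ _ that])
    show "A t v (j + k) = A t v j \<circ> A t v k" for v j k
      using z(1) y(1) by (auto simp: A_def fun_eq_iff power_int_add algebra_simps)
    show "A t v 0 = id" for v
      by (auto simp: A_def fun_eq_iff)
    show "A t v (int (vord v)) = id" for v
      using z(2)[of "int (vord a)"] y(2)[of "int (vord b)"] by (auto simp: A_def fun_eq_iff)
    show "A t u j \<circ> A t v k = A t v k \<circ> A t u j" if "u \<in> V" "v \<in> V" "E u v" for u v j k
      using that ab Eba E_irr by (auto simp: A_def fun_eq_iff)
  qed
  define \<alpha> where "\<alpha> w = z powi ex a w" for w
  define \<beta> where "\<beta> w = y powi ex b w" for w
  \<comment> \<open>The determinant does not depend on \<open>t\<close>, so the trace alone can
    vary; at 0 it also yields the missing entry \<open>s 0\<close>. The last two equations say that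
    at \<open>\<i>\<close> the vector (-\<i>, 1) has eigenvalue \<open>\<alpha> w\<close>.\<close>
  have shape: "\<exists>p q r s. continuous_on UNIV p \<and> continuous_on UNIV q \<and> continuous_on UNIV r \<and>
      continuous_on UNIV s \<and>
      (\<forall>t. act (A t) w = (\<lambda>(m, n). (p t * m + q t * n, r t * m + s t * n)) \<and>
        p t * s t - q t * r t = \<alpha> w * \<beta> w) \<and>
      p 0 = 1 \<and> q 0 = 0 \<and> r 0 = 0 \<and>
      p \<i> * (- \<i>) + q \<i> = - \<i> * \<alpha> w \<and> r \<i> * (- \<i>) + s \<i> = \<alpha> w" for w
  proof (induction w)
    case Nil
    show ?case
      by (intro exI[of _ "\<lambda>_. 1"] exI[of _ "\<lambda>_. 0"])
        (auto simp: fun_eq_iff \<alpha>_def \<beta>_def)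
  next
    case (Cons ug w)
    obtain u g where ug: "ug = (u, g)" by (cases ug)
    define k where "k = lg u g"
    have act_step: "act (A t) (ug # w) = A t u k \<circ> act (A t) w" for t
      by (simp add: ug k_def)
    have ex_step: "ex v (ug # w) = (if u = v then k else 0) + ex v w" for v
      by (simp add: ug k_def)
    obtain p q r s where IH: "continuous_on UNIV p" "continuous_on UNIV q" "continuous_on UNIV r"
      "continuous_on UNIV s"
      "\<And>t. act (A t) w = (\<lambda>(m, n). (p t * m + q t * n, r t * m + s t * n))"
      "\<And>t. p t * s t - q t * r t = \<alpha> w * \<beta> w"
      "p 0 = 1" "q 0 = 0" "r 0 = 0"
      "p \<i> * (- \<i>) + q \<i> = - \<i> * \<alpha> w" "r \<i> * (- \<i>) + s \<i> = \<alpha> w"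
      using Cons.IH by blast
    consider "u = a" | "u = b" | "u \<noteq> a" "u \<noteq> b" by blast
    then show ?case
    proof cases
      case 1
      define c where "c = z powi k"
      have \<alpha>: "\<alpha> (ug # w) = c * \<alpha> w" "\<beta> (ug # w) = \<beta> w"
        unfolding \<alpha>_def \<beta>_def ex_step using 1 ab z(1) by (simp_all add: c_def power_int_add)
      have act: "act (A t) (ug # w) = (\<lambda>(m, n). ((p t + t * (1 - c) * r t) * m
          + (q t + t * (1 - c) * s t) * n, (c * r t) * m + (c * s t) * n))" for t
        unfolding act_step 1 Aa IH(5) by (auto simp: fun_eq_iff c_def algebra_simps)
      have det: "(p t + t * (1 - c) * r t) * (c * s t) - (q t + t * (1 - c) * s t) * (c * r t)
          = c * \<alpha> w * \<beta> w" for t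
        using arg_cong[OF IH(6)[of t], of "\<lambda>h. c * h"] by (simp add: algebra_simps)
      have "(p \<i> + \<i> * (1 - c) * r \<i>) * (- \<i>) + (q \<i> + \<i> * (1 - c) * s \<i>)
          = (p \<i> * (- \<i>) + q \<i>) + \<i> * (1 - c) * (r \<i> * (- \<i>) + s \<i>)"
        by (simp add: algebra_simps)
      also have "\<dots> = - \<i> * (c * \<alpha> w)"
        unfolding IH by (simp add: algebra_simps)
      finally have i1: "(p \<i> + \<i> * (1 - c) * r \<i>) * (- \<i>) + (q \<i> + \<i> * (1 - c) * s \<i>)
          = - \<i> * (c * \<alpha> w)" .
      have "(c * r \<i>) * (- \<i>) + (c * s \<i>) = c * (r \<i> * (- \<i>) + s \<i>)"
        by (simp add: algebra_simps)
      then have i2: "(c * r \<i>) * (- \<i>) + (c * s \<i>) = c * \<alpha> w"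
        unfolding IH .
      show ?thesis
        unfolding \<alpha> using act det i1 i2 IH(1-4,7-9)
        by (intro exI[of _ "\<lambda>t. p t + t * (1 - c) * r t"] exI[of _ "\<lambda>t. q t + t * (1 - c) * s t"]
            exI[of _ "\<lambda>t. c * r t"] exI[of _ "\<lambda>t. c * s t"] conjI allI)
          (auto intro!: continuous_intros)
    next
      case 2
      define c where "c = y powi k"
      have \<alpha>: "\<alpha> (ug # w) = \<alpha> w" "\<beta> (ug # w) = c * \<beta> w"
        unfolding \<alpha>_def \<beta>_def ex_step using 2 ab y(1) by (simp_all add: c_def power_int_add)
      have act: "act (A t) (ug # w) = (\<lambda>(m, n). (p t * m + q t * n,
          (t * (1 - c) * p t + c * r t) * m + (t * (1 - c) * q t + c * s t) * n))" for t
        unfolding act_step 2 Ab IH(5) by (auto simp: fun_eq_iff c_def algebra_simps)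
      have det: "p t * (t * (1 - c) * q t + c * s t) - q t * (t * (1 - c) * p t + c * r t)
          = \<alpha> w * (c * \<beta> w)" for t
        using arg_cong[OF IH(6)[of t], of "\<lambda>h. c * h"] by (simp add: algebra_simps)
      have "(\<i> * (1 - c) * p \<i> + c * r \<i>) * (- \<i>) + (\<i> * (1 - c) * q \<i> + c * s \<i>)
          = \<i> * (1 - c) * (p \<i> * (- \<i>) + q \<i>) + c * (r \<i> * (- \<i>) + s \<i>)"
        by (simp add: algebra_simps)
      also have "\<dots> = \<alpha> w"
        unfolding IH by (simp add: algebra_simps)
      finally have i2: "(\<i> * (1 - c) * p \<i> + c * r \<i>) * (- \<i>) + (\<i> * (1 - c) * q \<i> + c * s \<i>)
          = \<alpha> w" .
      show ?thesis
        unfolding \<alpha> using act det i2 IH(1-4,7-10)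
        by (intro exI[of _ p] exI[of _ q] exI[of _ "\<lambda>t. t * (1 - c) * p t + c * r t"]
            exI[of _ "\<lambda>t. t * (1 - c) * q t + c * s t"] conjI allI)
          (auto intro!: continuous_intros)
    next
      case 3
      then have "\<alpha> (ug # w) = \<alpha> w" "\<beta> (ug # w) = \<beta> w" "act (A t) (ug # w) = act (A t) w" for t
        unfolding \<alpha>_def \<beta>_def act_step ex_step by (simp_all add: A_def)
      then show ?thesis using Cons.IH by simp
    qed
  qed
  obtain p q r s where S: "continuous_on UNIV p" "continuous_on UNIV s"
    "\<And>t. act (A t) x = (\<lambda>(m, n). (p t * m + q t * n, r t * m + s t * n))"
    "\<And>t. p t * s t - q t * r t = \<alpha> x * \<beta> x"
    "p 0 = 1" "q 0 = 0" "r 0 = 0"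
    "p \<i> * (- \<i>) + q \<i> = - \<i> * \<alpha> x" "r \<i> * (- \<i>) + s \<i> = \<alpha> x"
    using shape[of x] by blast
  have nz: "\<alpha> x \<noteq> 0" "\<beta> x \<noteq> 0" using z y by (simp_all add: \<alpha>_def \<beta>_def)
  obtain N where N: "N > 0" "R (wpow N x) []" using tors by (auto simp: torsion_def)
  let ?T = "(\<lambda>l. l + (\<alpha> x * \<beta> x) / l) ` {l. l ^ N = 1}"
  have "p t + s t \<in> ?T" for t
  proof (rule finite_order_trace)
    show "((\<lambda>(m, n). (p t * m + q t * n, r t * m + s t * n)) ^^ N) = id"
      using cong[OF N(2), of t] unfolding act_wpow S(3) by simp
    show "p t * s t - q t * r t = \<alpha> x * \<beta> x" by (rule S(4))
    show "\<alpha> x * \<beta> x \<noteq> 0" using nz by simp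
  qed
  moreover have "finite ?T"
    using N(1) by (intro finite_imageI finite_roots_unity) simp
  ultimately have "finite (range (\<lambda>t. p t + s t))"
    by (meson finite_subset image_subsetI)
  then have "(\<lambda>t. p t + s t) constant_on UNIV"
    using S(1,2) by (intro continuous_finite_range_constant continuous_intros connected_UNIV) auto
  then have "p 0 + s 0 = p \<i> + s \<i>"
    by (auto simp: constant_on_def)
  moreover have "s 0 = \<alpha> x * \<beta> x" using S(4)[of 0] S(5-7) by simp
  ultimately have tr: "p \<i> + s \<i> = 1 + \<alpha> x * \<beta> x" using S(5) by simp
  have p: "p \<i> = \<alpha> x - \<i> * q \<i>"
  proof -
    have "p \<i> = \<i> * (p \<i> * (- \<i>) + q \<i>) - \<i> * q \<i>" by (simp add: algebra_simps)
    then show ?thesis unfolding S(8) by simp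
  qed
  have s: "s \<i> = \<alpha> x + \<i> * r \<i>" using S(9) by (simp add: algebra_simps)
  \<comment> \<open>The characteristic equation for the eigenvalue \<open>\<alpha> x\<close>; it
    identifies the other eigenvalue at \<open>\<i>\<close> as \<open>\<beta> x\<close>.\<close>
  have "\<alpha> x * (p \<i> + s \<i> - \<alpha> x) = \<alpha> x * \<beta> x"
    unfolding S(4)[of \<i>, symmetric] p s by (simp add: algebra_simps)
  then have "p \<i> + s \<i> - \<alpha> x = \<beta> x" using nz by simp
  then have "p \<i> + s \<i> = \<alpha> x + \<beta> x" by (simp add: diff_eq_eq add.commute)
  then have "(1 - \<alpha> x) * (1 - \<beta> x) = 0" using tr by (simp add: algebra_simps)
  then have "\<alpha> x = 1 \<or> \<beta> x = 1" by auto
  then show ?thesis using z y by (simp add: \<alpha>_def \<beta>_def)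
qed

end

section \<open>Isomorphisms on the level of words\<close>

lemma additive_cong:
  fixes h :: "int \<Rightarrow> int"
  assumes "\<And>j k. [h (j + k) = h j + h k] (mod m)"
  shows "[h k = k * h 1] (mod m)"
proof -
  have "m dvd h (0 + 0) - (h 0 + h 0)"
    using assms[of 0 0] by (simp only: cong_iff_dvd_diff)
  then have zero: "m dvd h 0" by simp
  have step: "m dvd h (k + 1) - h k - h 1" for k
    using assms[of k 1] by (simp only: cong_iff_dvd_diff diff_diff_eq)
  have "m dvd h k - k * h 1"
  proof (induction k rule: int_induct[where k = 0])
    case base
    show ?case using zero by simp
  next
    case (step1 i)
    have "h (i + 1) - (i + 1) * h 1 = (h (i + 1) - h i - h 1) + (h i - i * h 1)"
      by (simp add: algebra_simps)
    then show ?case using step[of i] step1.IH by (metis dvd_add)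
  next
    case (step2 i)
    have "h (i - 1) - (i - 1) * h 1 = (h i - i * h 1) - (h (i - 1 + 1) - h (i - 1) - h 1)"
      by (simp add: algebra_simps)
    then show ?case using step[of "i - 1"] step2.IH by (metis dvd_diff)
  qed
  then show ?thesis by (simp only: cong_iff_dvd_diff)
qed

text \<open>The possible values of \<open>vord\<close>. Coding infinity as 0 lets any prime serve as
  a divisor of the order of an infinite vertex.\<close>

definition vertex_order :: "nat \<Rightarrow> bool" where
  "vertex_order n \<longleftrightarrow> n = 0 \<or> (\<exists>p k. Factorial_Ring.prime (p::nat) \<and> k > 0 \<and> n = p ^ k)"

lemma prime_dvd_of_power_dvd_mult:
  fixes p :: nat and x :: int
  assumes p: "Factorial_Ring.prime p" and lt: "l < k" and dvd: "int (p ^ k) dvd int (p ^ l) * x"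
  shows "int p dvd x"
proof -
  have "p ^ k = p ^ l * p ^ (k - l)" using lt by (simp flip: power_add)
  then have "int (p ^ l) * int (p ^ (k - l)) dvd int (p ^ l) * x"
    using dvd by simp
  moreover have "int (p ^ l) \<noteq> 0" using p by (simp add: prime_gt_0_nat)
  ultimately have "int (p ^ (k - l)) dvd x" by (simp only: dvd_mult_cancel_left) simp
  moreover have "int p dvd int (p ^ (k - l))"
    using lt by (simp add: dvd_power)
  ultimately show ?thesis by (rule dvd_trans[rotated])
qed

text \<open>Here \<open>x\<close> and \<open>y\<close> are the multipliers of homomorphisms between
  cyclic groups of orders \<open>n'\<close> and \<open>n\<close>, one in each direction. A map from
  a finite to an infinite group is zero; between powers of one prime, the map into the larger group
  has a multiplier divisible by that prime; for different primes, \<open>n'\<close> is invertible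
  modulo \<open>p\<close>.\<close>

lemma prime_dvd_cross_term:
  fixes x y :: int
  assumes n: "vertex_order n" and n': "vertex_order n'" and ne: "n \<noteq> n'"
    and dvd: "int n dvd int n' * x" "int n' dvd int n * y"
    and p: "Factorial_Ring.prime p" "p dvd n"
  shows "int p dvd x * y"
proof (cases "n = 0 \<or> n' = 0")
  case True
  then have "x = 0 \<or> y = 0" using dvd ne by auto
  then show ?thesis by auto
next
  case False
  then obtain q k q' l where q: "Factorial_Ring.prime q" "k > 0" "n = q ^ k"
    "Factorial_Ring.prime q'" "n' = q' ^ l"
    using n n' by (auto simp: vertex_order_def)
  have "p = q" using p q by (metis prime_dvd_power primes_dvd_imp_eq)
  show ?thesis
  proof (cases "q = q'")
    case True
    then have "l \<noteq> k" using ne q by auto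
    then consider "l < k" | "k < l" by linarith
    then show ?thesis
    proof cases
      case 1
      have "int p dvd x"
        using prime_dvd_of_power_dvd_mult[OF p(1) 1] dvd q \<open>p = q\<close> True by simp
      then show ?thesis by simp
    next
      case 2
      have "int p dvd y"
        using prime_dvd_of_power_dvd_mult[OF p(1) 2] dvd q \<open>p = q\<close> True by simp
      then show ?thesis by simp
    qed
  next
    case False
    then have "coprime q q'" using q by (simp add: primes_coprime)
    then have "coprime (int p) (int n')"
      using q \<open>p = q\<close> by simp
    moreover have "int p dvd int n' * x"
      using p dvd(1) by (metis dvd_trans int_dvd_int_iff)
    ultimately have "int p dvd x" by (simp add: coprime_dvd_mult_right_iff)
    then show ?thesis by simp
  qed
qed

lemma (in cyclic_graph_product) vertex_order_vord: "v \<in> V \<Longrightarrow> vertex_order (vord v)"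
  unfolding vertex_order_def by (erule vord_cases) blast+

context cyclic_graph_product
begin

section \<open>Generators as words, and blocks of vertices of equal order\<close>

definition letter :: "'a \<Rightarrow> ('a \<times> 'g) list" where
  "letter v = [(v, gen v)]"

definition level :: "nat \<Rightarrow> 'a set" where
  "level n = {v \<in> V. vord v = n}"

abbreviation words :: "('a \<times> 'g) list set" where
  "words \<equiv> gp_words V G"

lemma words_simps [simp]: "[] \<in> words" "(v, g) # w \<in> words \<longleftrightarrow> v \<in> V \<and> g \<in> carrier (G v) \<and> w \<in> words"
  "x @ y \<in> words \<longleftrightarrow> x \<in> words \<and> y \<in> words"
  by (auto simp: gp_words_def)

lemma letter_words [simp]: "v \<in> V \<Longrightarrow> letter v \<in> words"
  by (simp add: letter_def gen_closed)

lemma wpow_words: "x \<in> words \<Longrightarrow> wpow N x \<in> words"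
  by (induction N) auto

lemma commute_letters: "\<lbrakk>v \<in> V; w \<in> V; E v w\<rbrakk> \<Longrightarrow> commute (letter v) (letter w)"
  unfolding commute_def letter_def using gp_comm[of v V w E "gen v" G "gen w"] gen_closed by simp

lemma gp_pow_add:
  assumes "v \<in> V"
  shows "R [(v, gen v [^]\<^bsub>G v\<^esub> (j + k :: int))]
    ([(v, gen v [^]\<^bsub>G v\<^esub> j)] @ [(v, gen v [^]\<^bsub>G v\<^esub> k)])"
proof -
  interpret group "G v" by (rule grp[OF assms])
  have "gen v [^]\<^bsub>G v\<^esub> (j + k) = gen v [^]\<^bsub>G v\<^esub> j \<otimes>\<^bsub>G v\<^esub> gen v [^]\<^bsub>G v\<^esub> k"
    using gen_closed[OF assms] by (simp add: int_pow_mult)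
  then show ?thesis
    using gp_sym[OF gp_mult[where v = v and V = V and E = E and G = G
          and g = "gen v [^]\<^bsub>G v\<^esub> j" and h = "gen v [^]\<^bsub>G v\<^esub> k"]]
      assms gen_pow_closed[OF assms] by simp
qed

lemma gen_pow_1: assumes "v \<in> V" shows "gen v [^]\<^bsub>G v\<^esub> (1::int) = gen v"
proof -
  interpret group "G v" by (rule grp[OF assms])
  show ?thesis using gen_closed[OF assms] by simp
qed

lemma wpow_letter:
  assumes "v \<in> V"
  shows "R (wpow N (letter v)) [(v, gen v [^]\<^bsub>G v\<^esub> int N)]"
proof (induction N)
  case 0
  show ?case using gp_sym[OF gp_one[OF assms]] by simp
next
  case (Suc N)
  have "R (letter v @ wpow N (letter v)) (letter v @ [(v, gen v [^]\<^bsub>G v\<^esub> int N)])"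
    by (rule R_append[OF gp_refl Suc])
  moreover have "R (letter v @ [(v, gen v [^]\<^bsub>G v\<^esub> int N)]) [(v, gen v [^]\<^bsub>G v\<^esub> int (Suc N))]"
    using gp_sym[OF gp_pow_add[OF assms, of 1 "int N"]] gen_pow_1[OF assms]
    by (simp add: letter_def)
  ultimately show ?case unfolding wpow_simps by (rule gp_trans)
qed

lemma torsion_letter:
  assumes "v \<in> V" "vord v > 0"
  shows "torsion (letter v)"
proof -
  have "gen v [^]\<^bsub>G v\<^esub> int (vord v) = gen v [^]\<^bsub>G v\<^esub> (0::int)"
    unfolding pow_eq_iff[OF assms(1)] by (simp add: cong_def)
  then have "R (wpow (vord v) (letter v)) [(v, \<one>\<^bsub>G v\<^esub>)]"
    using wpow_letter[OF assms(1), of "vord v"] by simp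
  from gp_trans[OF this gp_one[OF assms(1)]] have "R (wpow (vord v) (letter v)) []" .
  then show ?thesis using assms by (auto simp: torsion_def)
qed

lemma ex_letter: "v \<in> V \<Longrightarrow> u \<in> V \<Longrightarrow> [ex u (letter v) = of_bool (u = v)] (mod int (vord u))"
  using lg_pow[of u 1] gen_pow_1[of u] by (auto simp: letter_def)

end

text \<open>A homomorphism of graph products lifted to chosen representatives. Since the choice is
  arbitrary, concatenation is respected only up to the relations.\<close>

locale word_hom = A: cyclic_graph_product V E G + B: cyclic_graph_product V' E' G'
  for V :: "'a set" and E and G :: "'a \<Rightarrow> ('g, 'c) monoid_scheme"
    and V' :: "'b set" and E' and G' :: "'b \<Rightarrow> ('h, 'd) monoid_scheme" +
  fixes f :: "('a \<times> 'g) list \<Rightarrow> ('b \<times> 'h) list"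
  assumes f_words: "x \<in> A.words \<Longrightarrow> f x \<in> B.words"
    and f_cong: "\<lbrakk>x \<in> A.words; y \<in> A.words; A.R x y\<rbrakk> \<Longrightarrow> B.R (f x) (f y)"
    and f_append: "\<lbrakk>x \<in> A.words; y \<in> A.words\<rbrakk> \<Longrightarrow> B.R (f (x @ y)) (f x @ f y)"
    and f_Nil: "B.R (f []) []"
begin

text \<open>Column \<open>v\<close> lists the exponents of the image of the generator at
  \<open>v\<close>; the entry in row \<open>u\<close> matters modulo the order at
  \<open>u\<close>.\<close>

definition \<Phi> :: "'b \<Rightarrow> 'a \<Rightarrow> int" where
  "\<Phi> u v = B.ex u (f (A.letter v))"

lemma ex_append:
  assumes "x \<in> A.words" "y \<in> A.words" "u \<in> V'"
  shows "[B.ex u (f (x @ y)) = B.ex u (f x) + B.ex u (f y)] (mod int (B.vord u))"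
  using B.ex_cong[OF f_append[OF assms(1,2)] assms(3)] by simp

lemma ex_pow:
  assumes v: "v \<in> V" and u: "u \<in> V'"
  shows "[B.ex u (f [(v, A.gen v [^]\<^bsub>G v\<^esub> (k::int))]) = k * \<Phi> u v] (mod int (B.vord u))"
proof -
  define h where "h k = B.ex u (f [(v, A.gen v [^]\<^bsub>G v\<^esub> (k::int))])" for k
  have W: "[(v, A.gen v [^]\<^bsub>G v\<^esub> (k::int))] \<in> A.words" for k
    using v A.gen_pow_closed by simp
  have "[h (j + k) = h j + h k] (mod int (B.vord u))" for j k
  proof -
    have "B.R (f [(v, A.gen v [^]\<^bsub>G v\<^esub> (j + k))])
        (f ([(v, A.gen v [^]\<^bsub>G v\<^esub> j)] @ [(v, A.gen v [^]\<^bsub>G v\<^esub> k)]))"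
      using W v by (intro f_cong A.gp_pow_add) (simp_all only: A.words_simps)
    from B.ex_cong[OF this u] ex_append[OF W W u, of j k] show ?thesis
      unfolding h_def by (rule cong_trans)
  qed
  from additive_cong[OF this, of k] show ?thesis
    unfolding h_def \<Phi>_def A.gen_pow_1[OF v] A.letter_def .
qed

lemma vord_dvd:
  assumes v: "v \<in> V" and u: "u \<in> V'"
  shows "int (B.vord u) dvd int (A.vord v) * \<Phi> u v"
proof -
  have "A.gen v [^]\<^bsub>G v\<^esub> int (A.vord v) = A.gen v [^]\<^bsub>G v\<^esub> (0::int)"
    unfolding A.pow_eq_iff[OF v] by (simp add: cong_def)
  then have "[int (A.vord v) * \<Phi> u v = 0 * \<Phi> u v] (mod int (B.vord u))"
    using ex_pow[OF assms, of "int (A.vord v)"] ex_pow[OF assms, of 0] by (metis cong_sym cong_trans)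
  then show ?thesis by (simp add: cong_0_iff)
qed

text \<open>The exponents of an image depend only on the exponents of the argument: on the
  abelianized level the homomorphism is the matrix \<open>\<Phi>\<close>.\<close>

lemma ex_hom:
  assumes u: "u \<in> V'"
  shows "y \<in> A.words \<Longrightarrow> [B.ex u (f y) = (\<Sum>v\<in>V. \<Phi> u v * A.ex v y)] (mod int (B.vord u))"
proof (induction y)
  case Nil
  show ?case using B.ex_cong[OF f_Nil u] by simp
next
  case (Cons xg y)
  obtain x g where xg: "xg = (x, g)" by (cases xg)
  have x: "x \<in> V" "g \<in> carrier (G x)" "y \<in> A.words" using Cons.prems by (auto simp: xg)
  have "[B.ex u (f ([(x, g)] @ y)) = B.ex u (f [(x, g)]) + B.ex u (f y)] (mod int (B.vord u))"
    using x u by (intro ex_append) simp_all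
  moreover have "[B.ex u (f [(x, g)]) + B.ex u (f y)
      = A.lg x g * \<Phi> u x + (\<Sum>v\<in>V. \<Phi> u v * A.ex v y)] (mod int (B.vord u))"
    using ex_pow[OF x(1) u, of "A.lg x g"] A.pow_lg[OF x(1,2)] Cons.IH[OF x(3)]
    by (intro cong_add) simp_all
  moreover have "(\<Sum>v\<in>V. \<Phi> u v * A.ex v (xg # y))
      = (\<Sum>v\<in>V. if x = v then \<Phi> u v * A.lg v g else 0) + (\<Sum>v\<in>V. \<Phi> u v * A.ex v y)"
    unfolding xg A.ex_simps sum.distrib[symmetric] by (intro sum.cong) (auto simp: algebra_simps)
  then have "(\<Sum>v\<in>V. \<Phi> u v * A.ex v (xg # y))
      = A.lg x g * \<Phi> u x + (\<Sum>v\<in>V. \<Phi> u v * A.ex v y)"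
    using x A.finV by (simp add: sum.delta mult.commute)
  ultimately show ?case by (simp only: xg append_Cons append_Nil) (rule cong_trans)
qed

lemma commute_hom:
  assumes "x \<in> A.words" "y \<in> A.words" "A.commute x y"
  shows "B.commute (f x) (f y)"
proof -
  have "B.R (f (x @ y)) (f (y @ x))"
    using assms by (intro f_cong) (simp_all add: A.commute_def)
  with f_append[OF assms(2,1)] have "B.R (f (x @ y)) (f y @ f x)" by (rule gp_trans[rotated])
  with gp_sym[OF f_append[OF assms(1,2)]] show ?thesis
    unfolding B.commute_def by (rule gp_trans)
qed

lemma wpow_hom: "x \<in> A.words \<Longrightarrow> B.R (f (A.wpow N x)) (B.wpow N (f x))"
proof (induction N)
  case (Suc N)
  have "B.R (f (x @ A.wpow N x)) (f x @ f (A.wpow N x))"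
    using Suc.prems A.wpow_words by (intro f_append) auto
  moreover have "B.R (f x @ f (A.wpow N x)) (f x @ B.wpow N (f x))"
    by (rule B.R_append[OF gp_refl Suc.IH[OF Suc.prems]])
  ultimately show ?case unfolding A.wpow_simps B.wpow_simps by (rule gp_trans)
qed (simp add: f_Nil)

lemma torsion_hom:
  assumes "x \<in> A.words" "A.torsion x"
  shows "B.torsion (f x)"
proof -
  obtain N where N: "N > 0" "A.R (A.wpow N x) []" using assms by (auto simp: A.torsion_def)
  have "B.R (B.wpow N (f x)) (f (A.wpow N x))" by (rule gp_sym[OF wpow_hom[OF assms(1)]])
  moreover have "B.R (f (A.wpow N x)) (f [])"
    using A.wpow_words[OF assms(1)] N by (intro f_cong) simp_all
  ultimately have "B.R (B.wpow N (f x)) []" using f_Nil gp_trans by metis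
  then show ?thesis using N by (auto simp: B.torsion_def)
qed

end

locale word_iso = word_hom V E G V' E' G' f + inv: word_hom V' E' G' V E G f'
  for V :: "'a set" and E and G :: "'a \<Rightarrow> ('g, 'c) monoid_scheme"
    and V' :: "'b set" and E' and G' :: "'b \<Rightarrow> ('h, 'd) monoid_scheme" and f f' +
  assumes f_f': "y \<in> B.words \<Longrightarrow> B.R (f (f' y)) y"
    and f'_f: "x \<in> A.words \<Longrightarrow> A.R (f' (f x)) x"
begin

lemma word_iso_swap: "word_iso V' E' G' V E G f' f"
  by unfold_locales (rule f'_f f_f'; assumption)+

abbreviation \<Psi> :: "'a \<Rightarrow> 'b \<Rightarrow> int" where
  "\<Psi> \<equiv> inv.\<Phi>"

text \<open>The product of the matrices describes \<open>f \<circ> f'\<close>, which is the identity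
  up to the relations. The modulus varies with the row, so a common prime modulus is available only
  on a block.\<close>

lemma right_inverse:
  assumes "u \<in> V'" "w \<in> V'"
  shows "[(\<Sum>v\<in>V. \<Phi> u v * \<Psi> v w) = of_bool (u = w)] (mod int (B.vord u))"
proof -
  have "[B.ex u (f (f' (B.letter w))) = (\<Sum>v\<in>V. \<Phi> u v * \<Psi> v w)] (mod int (B.vord u))"
    unfolding inv.\<Phi>_def using assms inv.f_words by (intro ex_hom) simp_all
  moreover have "[B.ex u (f (f' (B.letter w))) = B.ex u (B.letter w)] (mod int (B.vord u))"
    using assms by (intro B.ex_cong f_f') simp_all
  moreover have "[B.ex u (B.letter w) = of_bool (u = w)] (mod int (B.vord u))"
    using assms by (intro B.ex_letter)
  ultimately show ?thesis by (meson cong_sym cong_trans)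
qed

text \<open>Vertices of an order different from \<open>n\<close> contribute multiples of \<open>p\<close>, since
  \<open>\<Phi> u v\<close> is a homomorphism between cyclic groups of these orders.\<close>
lemma right_inverse_block:
  assumes p: "Factorial_Ring.prime p" "p dvd n" and uw: "u \<in> B.level n" "w \<in> B.level n"
  shows "[(\<Sum>v\<in>A.level n. \<Phi> u v * \<Psi> v w) = of_bool (u = w)] (mod int p)"
proof -
  have u: "u \<in> V'" "B.vord u = n" and w: "w \<in> V'" "B.vord w = n"
    using uw by (auto simp: B.level_def)
  have zero: "int p dvd \<Phi> u v * \<Psi> v w" if "v \<in> V - A.level n" for v
  proof (rule prime_dvd_cross_term[OF _ _ _ _ _ p])
    have v: "v \<in> V" "A.vord v \<noteq> n" using that by (auto simp: A.level_def)
    show "vertex_order n" "vertex_order (A.vord v)" "n \<noteq> A.vord v"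
      using B.vertex_order_vord[OF u(1)] A.vertex_order_vord[OF v(1)] u v by auto
    show "int n dvd int (A.vord v) * \<Phi> u v" "int (A.vord v) dvd int n * \<Psi> v w"
      using vord_dvd[OF v(1) u(1)] inv.vord_dvd[OF w(1) v(1)] u w by simp_all
  qed
  have "(\<Sum>v\<in>V. \<Phi> u v * \<Psi> v w) = (\<Sum>v\<in>V - A.level n. \<Phi> u v * \<Psi> v w) + (\<Sum>v\<in>A.level n. \<Phi> u v * \<Psi> v w)"
    using A.finV by (intro sum.subset_diff) (auto simp: A.level_def)
  moreover have "int p dvd (\<Sum>v\<in>V - A.level n. \<Phi> u v * \<Psi> v w)"
    using zero by (rule dvd_sum)
  ultimately have "[(\<Sum>v\<in>A.level n. \<Phi> u v * \<Psi> v w) = (\<Sum>v\<in>V. \<Phi> u v * \<Psi> v w)] (mod int p)"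
    by (simp add: cong_iff_dvd_diff)
  moreover have "[(\<Sum>v\<in>V. \<Phi> u v * \<Psi> v w) = of_bool (u = w)] (mod int p)"
    using right_inverse[OF u(1) w(1)] p(2) unfolding u(2)
    by (metis cong_dvd_modulus int_dvd_int_iff)
  ultimately show ?thesis by (rule cong_trans)
qed

end

section \<open>The graph isomorphism\<close>

lemma (in cyclic_graph_product) finite_level: "finite (level n)"
  using finV by (simp add: level_def)

context word_iso
begin

lemmas left_inverse_block = word_iso.right_inverse_block[OF word_iso_swap]

lemma minor_eq:
  assumes "v \<in> A.level 0" "w \<in> A.level 0" "E v w" "u \<in> B.level 0" "t \<in> B.level 0" "u \<noteq> t" "\<not> E' u t"
  shows "\<Phi> u v * \<Phi> t w = \<Phi> t v * \<Phi> u w"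
proof -
  have v: "v \<in> V" "w \<in> V" and u: "u \<in> V'" "t \<in> V'" "B.vord u = 0" "B.vord t = 0"
    using assms by (auto simp: A.level_def B.level_def)
  have "B.commute (f (A.letter v)) (f (A.letter w))"
    using v assms(3) by (intro commute_hom A.commute_letters A.letter_words)
  from B.heisenberg_action[OF u(1,2) assms(6,7) u(3,4) this] show ?thesis
    unfolding \<Phi>_def by (simp add: mult.commute)
qed

lemma parity_map_level: "parity_map (A.level 0) (B.level 0) E E' \<Phi> \<Psi>"
proof
  show "finite (A.level 0)" "finite (B.level 0)"
    by (rule A.finite_level, rule B.finite_level)
  show "E' v u" if "u \<in> B.level 0" "v \<in> B.level 0" "E' u v" for u v
    using that B.E_sym by (simp add: B.level_def)
  show "\<not> E v v" if "v \<in> A.level 0" for v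
    using that A.E_irr by (simp add: A.level_def)
  show "[(\<Sum>u\<in>B.level 0. \<Psi> v u * \<Phi> u w) = of_bool (v = w)] (mod 2)"
    if "v \<in> A.level 0" "w \<in> A.level 0" for v w
    using left_inverse_block[of 2 0 v w] that by (simp only: of_nat_numeral two_is_prime_nat dvd_0_right)
  show "[(\<Sum>v\<in>A.level 0. \<Phi> u v * \<Psi> v t) = of_bool (u = t)] (mod 2)"
    if "u \<in> B.level 0" "t \<in> B.level 0" for u t
    using right_inverse_block[of 2 0 u t] that by (simp only: of_nat_numeral two_is_prime_nat dvd_0_right)
  show "\<Phi> u v * \<Phi> t w = \<Phi> t v * \<Phi> u w"
    if "v \<in> A.level 0" "w \<in> A.level 0" "E v w" "u \<in> B.level 0" "t \<in> B.level 0" "u \<noteq> t" "\<not> E' u t"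
    for v w u t
    using that by (rule minor_eq)
qed

text \<open>Stated for every \<open>n\<close>, with empty levels where no vertex has order
  \<open>n\<close>, so that all bijections can be chosen at once. An edge condition appears only for
  infinite vertices; edges with a finite end are handled afterwards by \<open>edge_finite\<close>,
  from the nontrivial entries alone.\<close>

lemma level_bijection:
  "\<exists>s. bij_betw s (A.level n) (B.level n) \<and> (\<forall>v\<in>A.level n. \<not> int n dvd \<Phi> (s v) v) \<and>
    (n = 0 \<longrightarrow> (\<forall>v\<in>A.level 0. \<forall>w\<in>A.level 0. E v w \<longrightarrow> E' (s v) (s w)))"
proof -
  consider "n = 0" | p k where "Factorial_Ring.prime (p::nat)" "k > 0" "n = p ^ k"
    | "\<not> vertex_order n" by (auto simp: vertex_order_def)
  then show ?thesis
  proof cases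
    case 1
    obtain s where s: "bij_betw s (A.level 0) (B.level 0)" "\<And>v. v \<in> A.level 0 \<Longrightarrow> odd (\<Phi> (s v) v)"
      "\<And>v w. \<lbrakk>v \<in> A.level 0; w \<in> A.level 0; E v w\<rbrakk> \<Longrightarrow> E' (s v) (s w)"
      using parity_graph_morphism[OF parity_map_level word_iso.parity_map_level[OF word_iso_swap]]
      by blast
    have "\<Phi> (s v) v \<noteq> 0" if "v \<in> A.level 0" for v
      using s(2)[OF that] by auto
    then show ?thesis using s unfolding 1 by (intro exI[of _ s]) auto
  next
    case 2
    have pn: "p dvd n" using 2 by (simp add: dvd_power)
    have unit: "\<not> is_unit (int p)" using 2 by (metis int_dvd_int_iff not_prime_unit of_nat_1)
    have "card (A.level n) \<le> card (B.level n)"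
      by (rule right_invertible_mod_card_le[OF B.finite_level A.finite_level unit
            left_inverse_block[OF 2(1) pn]])
    then obtain s where s: "bij_betw s (A.level n) (B.level n)"
      "\<And>v. v \<in> A.level n \<Longrightarrow> \<not> int p dvd \<Phi> (s v) v"
    proof (rule invertible_mod_transversal[OF A.finite_level B.finite_level _ unit
          right_inverse_block[OF 2(1) pn], where R = "\<lambda>_ _. False" and \<kappa> = "\<lambda>_. ()"])
      fix \<sigma> assume "bij_betw \<sigma> (A.level n) (B.level n)"
        "\<And>v. v \<in> A.level n \<Longrightarrow> \<not> int p dvd \<Phi> (\<sigma> v) v"
      then show thesis by (rule that)
    qed (assumption | blast)+
    have "\<not> int n dvd \<Phi> (s v) v" if "v \<in> A.level n" for v
      using s(2)[OF that] pn by (metis dvd_trans int_dvd_int_iff)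
    moreover have "n \<noteq> 0" using 2 by auto
    ultimately show ?thesis using s by blast
  next
    case 3
    then have "A.level n = {}" "B.level n = {}"
      using A.vertex_order_vord B.vertex_order_vord by (auto simp: A.level_def B.level_def)
    moreover have "n \<noteq> 0" using 3 by (auto simp: vertex_order_def)
    ultimately show ?thesis by (simp add: bij_betw_def)
  qed
qed

lemma order_preserving_bijection:
  obtains \<sigma> where "bij_betw \<sigma> V V'" "\<And>v. v \<in> V \<Longrightarrow> B.vord (\<sigma> v) = A.vord v"
    "\<And>v. v \<in> V \<Longrightarrow> \<not> int (A.vord v) dvd \<Phi> (\<sigma> v) v"
    "\<And>v w. \<lbrakk>v \<in> A.level 0; w \<in> A.level 0; E v w\<rbrakk> \<Longrightarrow> E' (\<sigma> v) (\<sigma> w)"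
proof -
  have "\<exists>S. \<forall>n. bij_betw (S n) (A.level n) (B.level n) \<and>
      (\<forall>v\<in>A.level n. \<not> int n dvd \<Phi> (S n v) v) \<and>
      (n = 0 \<longrightarrow> (\<forall>v\<in>A.level 0. \<forall>w\<in>A.level 0. E v w \<longrightarrow> E' (S n v) (S n w)))"
    by (rule choice, rule allI, rule level_bijection)
  then obtain S where S_ex: "\<forall>n. bij_betw (S n) (A.level n) (B.level n) \<and>
      (\<forall>v\<in>A.level n. \<not> int n dvd \<Phi> (S n v) v) \<and>
      (n = 0 \<longrightarrow> (\<forall>v\<in>A.level 0. \<forall>w\<in>A.level 0. E v w \<longrightarrow> E' (S n v) (S n w)))"
    by (rule exE)
  note S_all = spec[OF S_ex]
  have S: "bij_betw (S n) (A.level n) (B.level n)"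
    "v \<in> A.level n \<Longrightarrow> \<not> int n dvd \<Phi> (S n v) v"
    "\<lbrakk>v \<in> A.level 0; w \<in> A.level 0; E v w\<rbrakk> \<Longrightarrow> E' (S 0 v) (S 0 w)" for n v w
    using S_all[of n] S_all[of 0] by simp_all
  define \<sigma> where "\<sigma> v = S (A.vord v) v" for v
  have lev: "v \<in> A.level (A.vord v)" if "v \<in> V" for v using that by (simp add: A.level_def)
  have img: "\<sigma> v \<in> B.level (A.vord v)" if "v \<in> V" for v
    unfolding \<sigma>_def using S(1) lev[OF that] by (rule bij_betw_apply)
  have inj: "inj_on \<sigma> V"
  proof (rule inj_onI)
    fix v w assume vw: "v \<in> V" "w \<in> V" "\<sigma> v = \<sigma> w"
    then have "A.vord v = A.vord w"
      using img[OF vw(1)] img[OF vw(2)] by (simp add: B.level_def)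
    then show "v = w"
      using vw S(1)[of "A.vord v"] lev[OF vw(1)] lev[OF vw(2)]
      unfolding \<sigma>_def bij_betw_def inj_on_def by simp
  qed
  have "V' \<subseteq> \<sigma> ` V"
  proof
    fix u assume u: "u \<in> V'"
    then have "u \<in> S (B.vord u) ` A.level (B.vord u)"
      using S(1)[of "B.vord u"] by (simp add: bij_betw_def B.level_def)
    then obtain v where "v \<in> A.level (B.vord u)" "u = S (B.vord u) v" by blast
    then have "v \<in> V" "u = \<sigma> v" by (auto simp: A.level_def \<sigma>_def)
    then show "u \<in> \<sigma> ` V" by blast
  qed
  moreover have "\<sigma> ` V \<subseteq> V'" using img by (auto simp: B.level_def)
  ultimately have "bij_betw \<sigma> V V'" using inj by (auto simp: bij_betw_def)
  moreover have "B.vord (\<sigma> v) = A.vord v" if "v \<in> V" for v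
    using img[OF that] by (simp add: B.level_def)
  moreover have "\<not> int (A.vord v) dvd \<Phi> (\<sigma> v) v" if "v \<in> V" for v
    unfolding \<sigma>_def using S(2)[OF lev[OF that]] .
  moreover have "E' (\<sigma> v) (\<sigma> w)" if "v \<in> A.level 0" "w \<in> A.level 0" "E v w" for v w
    using S(3)[OF that] that by (simp add: \<sigma>_def A.level_def)
  ultimately show thesis by (rule that)
qed

text \<open>Suppose \<open>u\<close> and \<open>t\<close> are not adjacent. If both ends are finite,
  the torsion elements \<open>x\<close> and \<open>y\<close> are nontrivial at \<open>u\<close> and
  at \<open>t\<close> respectively, hence trivial at the other vertex, so the torsion element
  \<open>x @ y\<close> is nontrivial at both. If \<open>w\<close> is infinite, \<open>x\<close> has
  exponent 0 at \<open>t\<close> while \<open>y\<close> does not, and the wreath product makes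
  \<open>x\<close> trivial at \<open>u\<close>.\<close>

lemma edge_finite:
  assumes v: "v \<in> V" "w \<in> V" "E v w" and u: "u \<in> V'" "t \<in> V'" "u \<noteq> t"
    and ord: "A.vord v > 0" "B.vord u > 0" "B.vord t > 0 \<longleftrightarrow> A.vord w > 0"
    and nz: "\<not> int (B.vord u) dvd \<Phi> u v" "\<not> int (B.vord t) dvd \<Phi> t w"
  shows "E' u t"
proof (rule ccontr)
  assume non: "\<not> E' u t"
  define x where "x = f (A.letter v)"
  define y where "y = f (A.letter w)"
  have comm: "B.commute x y"
    unfolding x_def y_def using v by (intro commute_hom A.commute_letters A.letter_words)
  have tor_x: "B.torsion x"
    unfolding x_def using v ord by (intro torsion_hom A.torsion_letter A.letter_words)
  have nz': "\<not> int (B.vord u) dvd B.ex u x" "\<not> int (B.vord t) dvd B.ex t y"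
    using nz by (simp_all add: x_def y_def \<Phi>_def)
  show False
  proof (cases "A.vord w > 0")
    case True
    then have t: "B.vord t > 0" using ord by simp
    have tor_y: "B.torsion y"
      unfolding y_def using v True by (intro torsion_hom A.torsion_letter A.letter_words)
    note T = B.torsion_nonadjacent[OF u non ord(2) t]
    have "int (B.vord t) dvd B.ex t x" using T[OF tor_x] nz' by blast
    moreover have "int (B.vord u) dvd B.ex u y" using T[OF tor_y] nz' by blast
    ultimately show False
      using T[OF B.torsion_append[OF comm tor_x tor_y]] nz'
      by (simp add: dvd_add_right_iff dvd_add_left_iff)
  next
    case False
    then have t: "B.vord t = 0" using ord by simp
    have "B.ex t x = 0" by (rule B.torsion_ex_infinite[OF tor_x u(2) t])
    moreover have "B.ex t y \<noteq> 0" using nz' t by simp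
    ultimately show False
      using B.wreath_action[OF u non ord(2) t comm] nz' by blast
  qed
qed

lemma edge_preserving_bijection:
  obtains \<sigma> where "bij_betw \<sigma> V V'" "\<And>v. v \<in> V \<Longrightarrow> B.vord (\<sigma> v) = A.vord v"
    "\<And>v w. \<lbrakk>v \<in> V; w \<in> V; E v w\<rbrakk> \<Longrightarrow> E' (\<sigma> v) (\<sigma> w)"
proof -
  obtain \<sigma> where \<sigma>: "bij_betw \<sigma> V V'" "\<And>v. v \<in> V \<Longrightarrow> B.vord (\<sigma> v) = A.vord v"
    "\<And>v. v \<in> V \<Longrightarrow> \<not> int (A.vord v) dvd \<Phi> (\<sigma> v) v"
    "\<And>v w. \<lbrakk>v \<in> A.level 0; w \<in> A.level 0; E v w\<rbrakk> \<Longrightarrow> E' (\<sigma> v) (\<sigma> w)"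
    using order_preserving_bijection by blast
  have \<sigma>V: "\<sigma> v \<in> V'" if "v \<in> V" for v using \<sigma>(1) that by (rule bij_betw_apply)
  have fin: "E' (\<sigma> v) (\<sigma> w)" if vw: "v \<in> V" "w \<in> V" "E v w" "A.vord v > 0" for v w
  proof (rule edge_finite[OF vw(1-3) \<sigma>V[OF vw(1)] \<sigma>V[OF vw(2)]])
    have "v \<noteq> w" using vw A.E_irr by blast
    then show "\<sigma> v \<noteq> \<sigma> w" using \<sigma>(1) vw by (auto simp: bij_betw_def inj_on_def)
  qed (use \<sigma>(2,3) vw in auto)
  have "E' (\<sigma> v) (\<sigma> w)" if vw: "v \<in> V" "w \<in> V" "E v w" for v w
  proof -
    consider "A.vord v > 0" | "A.vord w > 0" | "A.vord v = 0" "A.vord w = 0" by blast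
    then show ?thesis
    proof cases
      case 1
      then show ?thesis using fin vw by blast
    next
      case 2
      then have "E' (\<sigma> w) (\<sigma> v)" using fin vw A.E_sym by blast
      then show ?thesis using B.E_sym \<sigma>V vw by blast
    next
      case 3
      then show ?thesis using \<sigma>(4) vw by (simp add: A.level_def)
    qed
  qed
  then show thesis using that \<sigma>(1,2) by blast
qed

lemma vertex_group_iso:
  assumes v: "v \<in> V" and u: "u \<in> V'" and eq: "B.vord u = A.vord v"
  shows "G v \<cong> G' u"
proof -
  interpret H: group "G' u" by (rule B.grp[OF u])
  define h where "h g = B.gen u [^]\<^bsub>G' u\<^esub> A.lg v g" for g
  have pow: "h (A.gen v [^]\<^bsub>G v\<^esub> (k::int)) = B.gen u [^]\<^bsub>G' u\<^esub> k" for k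
    unfolding h_def B.pow_eq_iff[OF u] eq by (rule A.lg_pow[OF v])
  have "h \<in> hom (G v) (G' u)"
  proof (rule homI)
    show "h g \<in> carrier (G' u)" for g
      unfolding h_def by (rule B.gen_pow_closed[OF u])
    fix g g' assume g: "g \<in> carrier (G v)" "g' \<in> carrier (G v)"
    have "h (g \<otimes>\<^bsub>G v\<^esub> g') = B.gen u [^]\<^bsub>G' u\<^esub> (A.lg v g + A.lg v g')"
      unfolding h_def B.pow_eq_iff[OF u] eq by (rule A.lg_mult[OF v g])
    then show "h (g \<otimes>\<^bsub>G v\<^esub> g') = h g \<otimes>\<^bsub>G' u\<^esub> h g'"
      unfolding h_def using B.gen_closed[OF u] by (simp add: H.int_pow_mult)
  qed
  moreover have "inj_on h (carrier (G v))"
  proof (rule inj_onI)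
    fix g g' assume g: "g \<in> carrier (G v)" "g' \<in> carrier (G v)" "h g = h g'"
    then have "A.gen v [^]\<^bsub>G v\<^esub> A.lg v g = A.gen v [^]\<^bsub>G v\<^esub> A.lg v g'"
      unfolding h_def B.pow_eq_iff[OF u] A.pow_eq_iff[OF v] eq by simp
    then show "g = g'" using A.pow_lg[OF v] g by simp
  qed
  moreover have "h ` carrier (G v) = carrier (G' u)"
    unfolding A.gen_range[OF v] B.gen_range[OF u] image_image pow ..
  ultimately show ?thesis by (auto simp: is_iso_def iso_def bij_betw_def)
qed

end

text \<open>Each bijection injects the finite set of ordered edges of one graph into that of the
  other, so \<open>\<sigma>\<close> is also onto the edges. \<open>\<rho>\<close> need not be
  inverse to \<open>\<sigma>\<close>.\<close>

lemma edge_reflecting: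
  assumes fin: "finite V" "finite V'"
    and \<sigma>: "bij_betw \<sigma> V V'" "\<And>v w. \<lbrakk>v \<in> V; w \<in> V; E v w\<rbrakk> \<Longrightarrow> E' (\<sigma> v) (\<sigma> w)"
    and \<rho>: "bij_betw \<rho> V' V" "\<And>v w. \<lbrakk>v \<in> V'; w \<in> V'; E' v w\<rbrakk> \<Longrightarrow> E (\<rho> v) (\<rho> w)"
    and vw: "v \<in> V" "w \<in> V" "E' (\<sigma> v) (\<sigma> w)"
  shows "E v w"
proof -
  define D where "D = {(v, w). v \<in> V \<and> w \<in> V \<and> E v w}"
  define D' where "D' = {(v, w). v \<in> V' \<and> w \<in> V' \<and> E' v w}"
  have finD: "finite D" by (rule finite_subset[of _ "V \<times> V"]) (use fin in \<open>auto simp: D_def\<close>)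
  have finD': "finite D'" by (rule finite_subset[of _ "V' \<times> V'"]) (use fin in \<open>auto simp: D'_def\<close>)
  have \<sigma>V: "\<sigma> x \<in> V'" if "x \<in> V" for x using \<sigma>(1) that by (rule bij_betw_apply)
  have \<rho>V: "\<rho> x \<in> V" if "x \<in> V'" for x using \<rho>(1) that by (rule bij_betw_apply)
  have injs: "inj_on \<sigma> V" "inj_on \<rho> V'" using \<sigma> \<rho> by (auto simp: bij_betw_def)
  have inj: "inj_on (map_prod \<sigma> \<sigma>) D" "inj_on (map_prod \<rho> \<rho>) D'"
    using injs by (auto simp: inj_on_def D_def D'_def)
  have sub: "map_prod \<sigma> \<sigma> ` D \<subseteq> D'" "map_prod \<rho> \<rho> ` D' \<subseteq> D"
    using \<sigma>(2) \<rho>(2) \<sigma>V \<rho>V by (auto simp: D_def D'_def)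
  have "card D' \<le> card D" by (rule card_inj_on_le[OF inj(2) sub(2) finD])
  then have "card D' \<le> card (map_prod \<sigma> \<sigma> ` D)" by (simp add: card_image inj(1))
  then have "map_prod \<sigma> \<sigma> ` D = D'"
    by (rule card_seteq[OF finD' sub(1)])
  moreover have "(\<sigma> v, \<sigma> w) \<in> D'" using vw \<sigma>V by (simp add: D'_def)
  ultimately obtain a b where "(a, b) \<in> D" "\<sigma> a = \<sigma> v" "\<sigma> b = \<sigma> w" by auto
  then show ?thesis using injs(1) vw by (auto simp: D_def inj_on_def)
qed

lemma (in word_iso) labeled_graph_iso_exists: "\<exists>\<sigma>. labeled_graph_iso \<sigma> V E G V' E' G'"
proof -
  obtain \<sigma> where \<sigma>: "bij_betw \<sigma> V V'" "\<And>v. v \<in> V \<Longrightarrow> B.vord (\<sigma> v) = A.vord v"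
    "\<And>v w. \<lbrakk>v \<in> V; w \<in> V; E v w\<rbrakk> \<Longrightarrow> E' (\<sigma> v) (\<sigma> w)"
    by (rule edge_preserving_bijection) (assumption | rule that)+
  obtain \<rho> where \<rho>: "bij_betw \<rho> V' V" "\<And>v. v \<in> V' \<Longrightarrow> A.vord (\<rho> v) = B.vord v"
    "\<And>v w. \<lbrakk>v \<in> V'; w \<in> V'; E' v w\<rbrakk> \<Longrightarrow> E (\<rho> v) (\<rho> w)"
    by (rule word_iso.edge_preserving_bijection[OF word_iso_swap]) (assumption | rule that)+
  have reflect: "E v w" if "v \<in> V" "w \<in> V" "E' (\<sigma> v) (\<sigma> w)" for v w
    by (rule edge_reflecting[where \<sigma> = \<sigma> and \<rho> = \<rho> and E = E and E' = E', OF A.finV B.finV \<sigma>(1,3) \<rho>(1,3) that])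
  have "G v \<cong> G' (\<sigma> v)" if "v \<in> V" for v
    using vertex_group_iso[OF that bij_betw_apply[OF \<sigma>(1) that] \<sigma>(2)[OF that]] .
  moreover have "E v w \<longleftrightarrow> E' (\<sigma> v) (\<sigma> w)" if "v \<in> V" "w \<in> V" for v w
    using \<sigma>(3)[OF that] reflect[OF that] by (rule iffI)
  ultimately have "labeled_graph_iso \<sigma> V E G V' E' G'"
    unfolding labeled_graph_iso_def using \<sigma>(1) by simp
  then show ?thesis by (rule exI[of _ \<sigma>])
qed

section \<open>From an isomorphism of the quotient groups to maps of words\<close>

context cyclic_graph_product
begin

abbreviation cls :: "('a \<times> 'g) list \<Rightarrow> ('a \<times> 'g) list set" where
  "cls \<equiv> gp_class V E G"

lemma cls_eq_iff: "cls x = cls y \<longleftrightarrow> R x y"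
proof
  assume "cls x = cls y"
  then have "y \<in> cls x" using gp_refl[of V E G y] by (simp add: gp_class_def)
  then show "R x y" by (simp add: gp_class_def)
next
  assume "R x y"
  then have "R x z \<longleftrightarrow> R y z" for z
    by (intro iffI) (rule gp_trans[OF gp_sym], assumption+, rule gp_trans)
  then show "cls x = cls y" by (simp add: gp_class_def)
qed

lemma cls_mult: "cls x \<otimes>\<^bsub>graph_product V E G\<^esub> cls y = cls (x @ y)"
proof -
  have "cls (a @ b) = cls (x @ y)" if "a \<in> cls x" "b \<in> cls y" for a b
  proof -
    have "R (x @ y) (a @ b)"
      using that by (intro R_append) (simp_all add: gp_class_def)
    then have "R (a @ b) (x @ y)" by (rule gp_sym)
    then show ?thesis by (simp only: cls_eq_iff)
  qed
  then have "(\<Union>a\<in>cls x. \<Union>b\<in>cls y. cls (a @ b)) = (\<Union>a\<in>cls x. \<Union>b\<in>cls y. cls (x @ y))"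
    by (intro SUP_cong refl)
  also have "\<dots> = cls (x @ y)"
  proof -
    have "x \<in> cls x" "y \<in> cls y" by (simp_all add: gp_class_def gp_refl)
    then have "cls x \<noteq> {}" "cls y \<noteq> {}" by auto
    then show ?thesis by simp
  qed
  finally show ?thesis by (simp add: graph_product_def)
qed

lemma carrier_graph_product: "carrier (graph_product V E G) = cls ` words"
  by (simp add: graph_product_def)

end

lemma word_hom_of_hom:
  fixes V :: "'a set" and G :: "'a \<Rightarrow> ('g, 'c) monoid_scheme"
    and V' :: "'b set" and G' :: "'b \<Rightarrow> ('h, 'd) monoid_scheme"
  assumes "cyclic_graph_product V E G" "cyclic_graph_product V' E' G'"
    and h: "h \<in> iso (graph_product V E G) (graph_product V' E' G')"
    and f: "\<And>x. x \<in> gp_words V G \<Longrightarrow> f x \<in> gp_words V' G'"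
      "\<And>x. x \<in> gp_words V G \<Longrightarrow> h (gp_class V E G x) = gp_class V' E' G' (f x)"
  shows "word_hom V E G V' E' G' f"
proof -
  interpret A: cyclic_graph_product V E G by fact
  interpret B: cyclic_graph_product V' E' G' by fact
  have append: "B.R (f (x @ y)) (f x @ f y)" if "x \<in> A.words" "y \<in> A.words" for x y
  proof -
    have "h (A.cls x \<otimes>\<^bsub>graph_product V E G\<^esub> A.cls y)
        = h (A.cls x) \<otimes>\<^bsub>graph_product V' E' G'\<^esub> h (A.cls y)"
      using h that by (intro hom_mult) (auto simp: iso_def A.carrier_graph_product)
    then have "B.cls (f (x @ y)) = B.cls (f x @ f y)"
      using f that by (simp only: A.cls_mult B.cls_mult A.words_simps)
    then show ?thesis by (simp only: B.cls_eq_iff)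
  qed
  show ?thesis
  proof
    show "f x \<in> B.words" if "x \<in> A.words" for x by (rule f(1)[OF that])
    show "B.R (f x) (f y)" if "x \<in> A.words" "y \<in> A.words" "A.R x y" for x y
    proof -
      have "A.cls x = A.cls y" using that by (simp only: A.cls_eq_iff)
      then have "B.cls (f x) = B.cls (f y)"
        using f(2)[OF that(1)] f(2)[OF that(2)] by simp
      then show ?thesis by (simp only: B.cls_eq_iff)
    qed
    show "B.R (f (x @ y)) (f x @ f y)" if "x \<in> A.words" "y \<in> A.words" for x y
      by (rule append[OF that])
    \<comment> \<open>Preservation of the identity comes from surjectivity: for some
      \<open>e\<close> with trivial image, \<open>f []\<close> is equivalent to
      \<open>f e @ f []\<close>, hence to \<open>f e\<close> and to the empty word.\<close>
    have "B.cls [] \<in> h ` carrier (graph_product V E G)"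
      using h by (auto simp: iso_def bij_betw_def B.carrier_graph_product)
    then obtain e where e: "e \<in> A.words" "B.cls [] = h (A.cls e)"
      by (auto simp: A.carrier_graph_product)
    then have "B.cls (f e) = B.cls []" using f(2)[OF e(1)] by simp
    then have fe: "B.R (f e) []" by (simp only: B.cls_eq_iff)
    have "B.R (f e) (f e @ f [])" using append[of e "[]"] e by simp
    moreover have "B.R (f e @ f []) (f [])"
      using B.R_append[OF fe gp_refl[of V' E' G' "f []"]] by simp
    ultimately have "B.R (f e) (f [])" by (rule gp_trans)
    with gp_sym[OF fe] have "B.R [] (f [])" by (rule gp_trans)
    then show "B.R (f []) []" by (rule gp_sym)
  qed
qed

theorem theorem5p3:
  fixes V :: "'a set" and E :: "'a \<Rightarrow> 'a \<Rightarrow> bool" and G :: "'a \<Rightarrow> 'g monoid"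
    and V' :: "'b set" and E' :: "'b \<Rightarrow> 'b \<Rightarrow> bool" and G' :: "'b \<Rightarrow> 'h monoid"
  assumes "labeled_graph V E G" and "labeled_graph V' E' G'"
    and "\<forall>v\<in>V. dir_indec_cyclic (G v)" and "\<forall>v\<in>V'. dir_indec_cyclic (G' v)"
    and "graph_product V E G \<cong> graph_product V' E' G'"
  shows "\<exists>f. labeled_graph_iso f V E G V' E' G'"
proof -
  interpret A: cyclic_graph_product V E G
    using assms by unfold_locales auto
  interpret B: cyclic_graph_product V' E' G'
    using assms by unfold_locales auto
  obtain h where h: "h \<in> iso (graph_product V E G) (graph_product V' E' G')"
    using assms(5) by (auto simp: is_iso_def)
  then have bij: "bij_betw h (A.cls ` A.words) (B.cls ` B.words)"
    by (simp add: iso_def A.carrier_graph_product B.carrier_graph_product)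
  have "h (A.cls x) \<in> B.cls ` B.words" if "x \<in> A.words" for x
    using that by (intro bij_betw_apply[OF bij]) simp
  then have "\<forall>x. \<exists>y. x \<in> A.words \<longrightarrow> y \<in> B.words \<and> h (A.cls x) = B.cls y" by blast
  then obtain f where f: "\<And>x. x \<in> A.words \<Longrightarrow> f x \<in> B.words"
    "\<And>x. x \<in> A.words \<Longrightarrow> h (A.cls x) = B.cls (f x)" by metis
  have "\<exists>x. x \<in> A.words \<and> h (A.cls x) = B.cls y" if "y \<in> B.words" for y
  proof -
    have "B.cls y \<in> h ` (A.cls ` A.words)"
      using bij that unfolding bij_betw_def by blast
    then show ?thesis by (elim imageE) auto
  qed
  then have "\<forall>y. \<exists>x. y \<in> B.words \<longrightarrow> x \<in> A.words \<and> h (A.cls x) = B.cls y" by blast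
  then obtain f' where f': "\<And>y. y \<in> B.words \<Longrightarrow> f' y \<in> A.words"
    "\<And>y. y \<in> B.words \<Longrightarrow> h (A.cls (f' y)) = B.cls y" by metis
  interpret F: word_hom V E G V' E' G' f
    by (rule word_hom_of_hom[OF A.cyclic_graph_product_axioms B.cyclic_graph_product_axioms h f])
  have ff': "B.R (f (f' y)) y" if "y \<in> B.words" for y
  proof -
    have "B.cls (f (f' y)) = B.cls y"
      using f(2)[OF f'(1)[OF that]] f'(2)[OF that] by simp
    then show ?thesis by (simp only: B.cls_eq_iff)
  qed
  have f'f: "A.R (f' (f x)) x" if "x \<in> A.words" for x
  proof -
    have "h (A.cls (f' (f x))) = h (A.cls x)"
      using f'(2)[OF f(1)[OF that]] f(2)[OF that] by simp
    then have "A.cls (f' (f x)) = A.cls x"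
      using bij f'(1)[OF f(1)[OF that]] that by (auto simp: bij_betw_def inj_on_def)
    then show ?thesis by (simp only: A.cls_eq_iff)
  qed
  \<comment> \<open>With this, relations between values of \<open>f'\<close> can be verified after
    applying \<open>f\<close>, where \<open>f (f' y)\<close> reduces to \<open>y\<close>.\<close>
  have inj: "A.R x y" if "x \<in> A.words" "y \<in> A.words" "B.R (f x) (f y)" for x y
  proof -
    have "h (A.cls x) = h (A.cls y)"
      using that f(2) by (simp only: B.cls_eq_iff)
    then have "A.cls x = A.cls y"
      using bij that by (auto simp: bij_betw_def inj_on_def)
    then show ?thesis by (simp only: A.cls_eq_iff)
  qed
  interpret F': word_hom V' E' G' V E G f'
  proof
    show "f' y \<in> A.words" if "y \<in> B.words" for y by (rule f'(1)[OF that])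
    show "A.R (f' x) (f' y)" if "x \<in> B.words" "y \<in> B.words" "B.R x y" for x y
      using inj[of "f' x" "f' y"] that f' ff' by (meson gp_sym gp_trans)
    show "A.R (f' (x @ y)) (f' x @ f' y)" if xy: "x \<in> B.words" "y \<in> B.words" for x y
    proof (rule inj)
      have "B.R (f (f' x @ f' y)) (f (f' x) @ f (f' y))"
        using f' xy by (intro F.f_append)
      moreover have "B.R (f (f' x) @ f (f' y)) (x @ y)"
        using ff' xy by (intro B.R_append)
      moreover have "B.R (f (f' (x @ y))) (x @ y)"
        using xy by (intro ff') simp
      ultimately show "B.R (f (f' (x @ y))) (f (f' x @ f' y))" by (meson gp_sym gp_trans)
    qed (use f' xy in simp_all)
    show "A.R (f' []) []"
    proof (rule inj)
      show "B.R (f (f' [])) (f [])"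
        using gp_trans[OF ff' gp_sym[OF F.f_Nil]] by simp
    qed (use f' in simp_all)
  qed
  interpret word_iso V E G V' E' G' f f'
    by unfold_locales (rule ff' f'f; assumption)+
  show ?thesis by (rule labeled_graph_iso_exists)
qed

end
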